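(* Let $f(x,y) = \binom{6}{1} x^5 y - \binom{6}{3} x^3 y^3 = 2x^3y(3x^2 - 10y^2)$. For every field $K \subseteq \mathbb{C}$, $L_K(f) = 4$ if and only if $s(K) \le 2$. In particular, if $m$ is a positive square-free integer and $m \not\equiv 7 \pmod 8$, then $L_{\mathbb{Q}(\sqrt{-m})}(f) = 4$. Further, $L_{\mathbb{Q}(\sqrt{-7})}(f) = 5$.
   Context: For a binary form (homogeneous polynomial) $f(x,y)$ of degree $d$ with coefficients in a field $K \subseteq \mathbb{C}$, the $K$-rank (or $K$-length) $L_K(f)$ is the smallest integer $r$ for which there is a representation $$f(x,y) = \sum_{j=1}^r \lambda_j(\alpha_j x + \beta_j y)^d$$ with $\lambda_j, \alpha_j, \beta_j \in K$ for all $j$. The Stufe $s(K)$ of a non-real field $K$ is the smallest integer $n$ such that $-1$ can be written as a sum of $n$ squares in $K$. The condition $s(K) \le 2$ means that there exist $r, s \in K$ with $r^2 + s^2 = -1$ (in particular it fails if $-1$ is not a sum of squares in $K$). *)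

theory Defs
  imports
    Complex_Main
    "HOL-Library.Extended_Nat"
    "HOL-Algebra.Generated_Fields"
    "HOL-Algebra.Algebraic_Closure_Type"
begin

abbreviation complex_field :: "complex ring" where
  "complex_field \<equiv> ring_of_type_algebra"

definition quadratic_field :: "int \<Rightarrow> complex set" where
  "quadratic_field n = generate_field complex_field {csqrt (of_int n)}"

text \<open>
  Polynomials in \<open>x\<close> and \<open>y\<close> are elements of \<open>(\<complex>[x])[y]\<close>, so that identities between them
  are identities of polynomials, that is, of all coefficients.
\<close>

type_synonym bipoly = "complex poly poly"

definition cst :: "complex \<Rightarrow> bipoly" where
  "cst c = [:[:c:]:]"

definition var_x :: bipoly where
  "var_x = [:[:0, 1:]:]"

definition var_y :: bipoly where
  "var_y = [:0, 1:]"

definition has_representation :: "complex set \<Rightarrow> nat \<Rightarrow> bipoly \<Rightarrow> nat \<Rightarrow> bool" where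
  "has_representation K d f r \<longleftrightarrow>
     (\<exists>c \<alpha> \<beta> :: nat \<Rightarrow> complex.
        (\<forall>j\<in>{1..r}. c j \<in> K \<and> \<alpha> j \<in> K \<and> \<beta> j \<in> K) \<and>
        f = (\<Sum>j=1..r. cst (c j) * (cst (\<alpha> j) * var_x + cst (\<beta> j) * var_y) ^ d))"

text \<open>
  The length of a binary form \<open>f\<close> of degree \<open>d\<close>. The infimum in \<^typ>\<open>enat\<close> is the least element
  of the set, or \<open>\<infinity>\<close> if the set is empty. Likewise, a real field has Stufe \<open>\<infinity>\<close> below.
\<close>

definition form_length :: "complex set \<Rightarrow> nat \<Rightarrow> bipoly \<Rightarrow> enat" where
  "form_length K d f = Inf (enat ` {r. has_representation K d f r})"

definition stufe :: "complex set \<Rightarrow> enat" where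
  "stufe K = Inf (enat ` {n. \<exists>c :: nat \<Rightarrow> complex.
     (\<forall>i\<in>{1..n}. c i \<in> K) \<and> - 1 = (\<Sum>i=1..n. c i ^ 2)})"

definition sextic :: bipoly where
  "sextic = of_nat (6 choose 1) * var_x ^ 5 * var_y - of_nat (6 choose 3) * var_x ^ 3 * var_y ^ 3"

end

theory Submission
imports
  Defs
  "HOL-Number_Theory.Number_Theory"
  "HOL-Computational_Algebra.Squarefree"
  "HOL-Analysis.Summation_Tests"
begin

text \<open>
  Write \<open>f = \<Sum>\<^sub>k (6 choose k) a\<^sub>k x\<^bsup>6-k\<^esup> y\<^bsup>k\<^esup>\<close>. By Sylvester's apolarity argument, for a representation of
  \<open>f\<close> by at most four nonzero linear forms \<open>\<alpha>\<^sub>j x + \<beta>\<^sub>j y\<close> the quartic \<open>\<Prod>\<^sub>j (\<beta>\<^sub>j x - \<alpha>\<^sub>j y)\<close>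
  is a linear combination of \<open>x\<^sup>4 + x\<^sup>2 y\<^sup>2\<close> and \<open>y\<^sup>4\<close>. Its roots have \<open>e\<^sub>1 = e\<^sub>3 = 0\<close> and \<open>e\<^sub>2 = 1\<close>,
  so they are \<open>\<plusminus>u, \<plusminus>v\<close> with \<open>u\<^sup>2 + v\<^sup>2 = -1\<close>; conversely such \<open>u, v\<close> give a representation of length 4
  after a rotation of \<open>(u, v)\<close> into general position.

  In \<open>\<rat>(\<surd>-m)\<close> the equation \<open>u\<^sup>2 + v\<^sup>2 = -1\<close> is solvable once \<open>m w\<^sup>2 = x\<^sup>2 + y\<^sup>2 + z\<^sup>2\<close> is
  solvable over the integers with \<open>w \<noteq> 0\<close>. For the latter one looks for \<open>t = p\<close> or \<open>t = 2 p\<close> with a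
  prime \<open>p \<equiv> 1 (mod 4)\<close> such that \<open>m w\<^sup>2 = z\<^sup>2 + t v\<^sup>2\<close> is solvable by Legendre's theorem. This
  prescribes finitely many quadratic characters of \<open>p\<close>, so only the part of Dirichlet's theorem that
  concerns real characters is needed. For \<open>m = 7\<close> the equation is impossible modulo 8, and the
  representation of length 5 comes from the solution \<open>1 + 2 - 3 = 0\<close>, \<open>1\<^sup>2 + 2\<^sup>2 + 3\<^sup>2 = -2 (\<surd>-7)\<^sup>2\<close>.
\<close>

section \<open>Chebyshev estimates\<close>

lemma abel_identity:
  fixes a b :: "nat \<Rightarrow> real"
  assumes "m \<le> k"
  shows "(\<Sum>n=m..k. a n * b n) =
    (\<Sum>n=m..k. a n) * b k + (\<Sum>n=m..<k. (\<Sum>i=m..n. a i) * (b n - b (Suc n)))"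
  using assms
proof (induction k rule: dec_induct)
  case (step k)
  have "(\<Sum>n=m..<Suc k. (\<Sum>i=m..n. a i) * (b n - b (Suc n))) =
      (\<Sum>n=m..<k. (\<Sum>i=m..n. a i) * (b n - b (Suc n))) + (\<Sum>i=m..k. a i) * (b k - b (Suc k))"
    using step by simp
  moreover have "(\<Sum>n=m..Suc k. a n) = (\<Sum>n=m..k. a n) + a (Suc k)"
    using step by simp
  moreover have "(\<Sum>n=m..Suc k. a n * b n) = (\<Sum>n=m..k. a n * b n) + a (Suc k) * b (Suc k)"
    using step by simp
  ultimately show ?case using step.IH by (simp add: algebra_simps)
qed simp

text \<open>After summation by parts the weights \<open>b k\<close> and
  \<open>b n - b (Suc n)\<close> are nonnegative and telescope to \<open>b m\<close>, so a uniform
  bound on the partial sums carries over.\<close>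

lemma abel_bound:
  fixes a b :: "nat \<Rightarrow> real"
  assumes "\<And>k. m \<le> k \<Longrightarrow> \<bar>\<Sum>n=m..k. a n\<bar> \<le> B"
    and "\<And>n. m \<le> n \<Longrightarrow> b (Suc n) \<le> b n" and "\<And>n. m \<le> n \<Longrightarrow> 0 \<le> b n"
    and "0 \<le> B"
  shows "\<bar>\<Sum>n=m..k. a n * b n\<bar> \<le> B * b m"
proof (cases "m \<le> k")
  case True
  have "\<bar>\<Sum>n=m..<k. (\<Sum>i=m..n. a i) * (b n - b (Suc n))\<bar> \<le> (\<Sum>n=m..<k. B * (b n - b (Suc n)))"
    by (rule order_trans[OF sum_abs], rule sum_mono)
      (use assms in \<open>auto simp: abs_mult intro!: mult_mono\<close>)
  also have "\<dots> = B * (b m - b k)"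
    unfolding sum_distrib_left[symmetric] using sum_Suc_diff'[OF True, of "\<lambda>n. - b n"] by simp
  finally have 1: "\<bar>\<Sum>n=m..<k. (\<Sum>i=m..n. a i) * (b n - b (Suc n))\<bar> \<le> B * (b m - b k)" .
  have 2: "\<bar>(\<Sum>n=m..k. a n) * b k\<bar> \<le> B * b k"
    using assms True by (auto simp: abs_mult intro!: mult_right_mono)
  show ?thesis
    unfolding abel_identity[OF True] using 1 2 by (simp add: algebra_simps)
next
  case False
  then show ?thesis using assms by simp
qed

text \<open>Both sides run over the pairs of positive d, e with d e \<le> x.\<close>

lemma divisor_sum_swap:
  fixes g :: "nat \<Rightarrow> nat \<Rightarrow> 'a :: comm_monoid_add"
  shows "(\<Sum>n=1..x. \<Sum>d | d dvd n. g d (n div d)) = (\<Sum>d=1..x. \<Sum>e=1..x div d. g d e)"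
proof -
  have "(\<Sum>n=1..x. \<Sum>d | d dvd n. g d (n div d)) =
      (\<Sum>(n,d)\<in>(SIGMA n:{1..x}. {d. d dvd n}). g d (n div d))"
    by (rule sum.Sigma) auto
  also have "\<dots> = (\<Sum>(d,e)\<in>(SIGMA d:{1..x}. {1..x div d}). g d e)"
  proof (rule sum.reindex_bij_witness[where
        i = "\<lambda>(d,e). (d * e, d)" and j = "\<lambda>(n,d). (d, n div d)"], goal_cases)
    case (2 a)
    then obtain n d where a: "a = (n, d)" "1 \<le> n" "n \<le> x" "d dvd n" by auto
    then have "d \<le> n" by (simp add: dvd_imp_le)
    have "1 \<le> d" using a dvd_pos_nat[of n d] by simp
    have "1 \<le> n div d"
      using \<open>d \<le> n\<close> \<open>1 \<le> d\<close> by (simp add: div_greater_zero_iff Suc_le_eq dvd_imp_le)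
    with \<open>d \<le> n\<close> \<open>1 \<le> d\<close> show ?case using a by (auto intro: div_le_mono)
  next
    case (4 b)
    then show ?case
      by (auto simp: Suc_le_eq less_eq_div_iff_mult_less_eq mult.commute)
  qed auto
  also have "\<dots> = (\<Sum>d=1..x. \<Sum>e=1..x div d. g d e)"
    by (rule sum.Sigma[symmetric]) auto
  finally show ?thesis .
qed

text \<open>Each ln n is a sum of \<open>mangoldt\<close> over the divisors of n, and
  \<open>x div d\<close> counts the multiples of d up to x.\<close>

lemma ln_fact_eq_sum_mangoldt:
  "ln (fact x) = (\<Sum>d=1..x. (mangoldt d :: real) * real (x div d))"
proof -
  have "ln (fact x :: real) = (\<Sum>n=1..x. ln (real n))"
    unfolding fact_prod of_nat_prod by (rule ln_prod) auto
  also have "\<dots> = (\<Sum>n=1..x. \<Sum>d | d dvd n. (mangoldt d :: real))"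
    by (rule sum.cong) (simp_all add: mangoldt_sum)
  also have "\<dots> = (\<Sum>d=1..x. \<Sum>e=1..x div d. (mangoldt d :: real))"
    by (rule divisor_sum_swap)
  finally show ?thesis by (simp add: mult.commute)
qed

text \<open>Chebyshev's bound by halving x: the block from k+1 to 2k contributes at most 2k, and the
  constant 4 leaves room for the single extra term at odd x.\<close>

lemma sum_mangoldt_le: "(\<Sum>n=1..x. (mangoldt n :: real)) \<le> 4 * real x"
proof (induction x rule: less_induct)
  case (less x)
  have double: "(\<Sum>n=k+1..2*k. (mangoldt n :: real)) \<le> 2 * real k" for k
  proof -
    \<comment> \<open>The weight \<open>2*k div n\<close> minus twice \<open>k div n\<close> equals
      1 on this block and is never negative; summed over all n it yields the logarithm of the
      central binomial coefficient.\<close>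
    have "(\<Sum>n=k+1..2*k. (mangoldt n :: real)) \<le>
        (\<Sum>n=k+1..2*k. (mangoldt n :: real) * (real (2*k div n) - 2 * real (k div n)))"
    proof (rule sum_mono)
      fix n assume "n \<in> {k+1..2*k}"
      then have "k div n = 0" "2 * k div n = 1" by (auto simp: div_nat_eqI)
      then show "(mangoldt n :: real) \<le> (mangoldt n :: real) * (real (2*k div n) - 2 * real (k div n))"
        by simp
    qed
    also have "\<dots> \<le> (\<Sum>n=1..2*k. (mangoldt n :: real) * (real (2*k div n) - 2 * real (k div n)))"
    proof (rule sum_mono2)
      fix n :: nat
      have "2 * (k div n) \<le> 2 * k div n"
        by (cases "n = 0") (simp_all add: less_eq_div_iff_mult_less_eq)
      then have "0 \<le> real (2*k div n) - 2 * real (k div n)" by linarith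
      then show "0 \<le> (mangoldt n :: real) * (real (2*k div n) - 2 * real (k div n))"
        using mangoldt_nonneg by simp
    qed auto
    also have "\<dots> = ln (fact (2*k)) - 2 * (\<Sum>n=1..2*k. (mangoldt n :: real) * real (k div n))"
      unfolding ln_fact_eq_sum_mangoldt
      by (simp add: algebra_simps sum_subtractf sum_distrib_left)
    also have "(\<Sum>n=1..2*k. (mangoldt n :: real) * real (k div n)) = ln (fact k)"
      unfolding ln_fact_eq_sum_mangoldt by (rule sum.mono_neutral_right) auto
    also have "ln (fact (2*k)) - 2 * ln (fact k :: real) = ln (real (2 * k choose k))"
      by (simp add: binomial_fact ln_div ln_mult)
    also have "\<dots> \<le> ln (2 ^ (2 * k))"
    proof -
      have "real (2 * k choose k) \<le> real (2 ^ (2*k))"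
        using binomial_le_pow2[of "2*k" k] by (rule of_nat_mono)
      then show ?thesis by (subst ln_le_cancel_iff) (auto simp: zero_less_binomial)
    qed
    also have "\<dots> = 2 * real k * ln 2" by (simp add: ln_realpow)
    also have "\<dots> \<le> 2 * real k" using ln_2_less_1 mult_left_mono[of "ln 2" 1 "real k"] by simp
    finally show ?thesis .
  qed
  consider "x = 0" | "x = 1" | k where "k > 0" "x = 2 * k" | k where "k > 0" "x = 2 * k + 1"
    by (cases "even x"; cases "x \<le> 1") (auto elim!: evenE oddE)
  then show ?case
  proof cases
    case (3 k)
    have "(\<Sum>n=1..2*k. (mangoldt n :: real)) = (\<Sum>n=1..k. mangoldt n) + (\<Sum>n=k+1..2*k. mangoldt n)"
      using sum.ub_add_nat[of 1 k mangoldt k] by (simp add: mult_2)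
    with less.IH[of k] double[of k] 3 show ?thesis by simp
  next
    case (4 k)
    have "(\<Sum>n=1..2*k. (mangoldt n :: real)) = (\<Sum>n=1..k. mangoldt n) + (\<Sum>n=k+1..2*k. mangoldt n)"
      using sum.ub_add_nat[of 1 k mangoldt k] by (simp add: mult_2)
    moreover have "(mangoldt (2 * k + 1) :: real) \<le> 2 * real k"
      using mangoldt_le[of "2*k+1"] ln_le_minus_one[of "real (2*k+1)"] by simp
    ultimately show ?thesis using less.IH[of k] double[of k] 4 by simp
  qed auto
qed

text \<open>Lower half of Mertens' first theorem: the term of index x in the series of exp x gives
  ln x! \<ge> x ln x - x, and x! is expanded by \<open>ln_fact_eq_sum_mangoldt\<close> with the
  floors dropped.\<close>

lemma sum_mangoldt_div_ge: "x \<ge> 1 \<Longrightarrow> ln (real x) - 1 \<le> (\<Sum>n=1..x. (mangoldt n :: real) / real n)"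
proof -
  assume x: "x \<ge> 1"
  have "real x ^ x / fact x \<le> exp (real x)"
  proof -
    have "(\<Sum>n<Suc x. real x ^ n /\<^sub>R fact n) \<le> exp (real x)"
      unfolding exp_def by (rule sum_le_suminf[OF summable_exp_generic]) auto
    moreover have "0 \<le> (\<Sum>n<x. real x ^ n /\<^sub>R fact n)" by (rule sum_nonneg) auto
    ultimately show ?thesis by (simp add: divide_inverse mult.commute)
  qed
  then have "ln (real x ^ x / fact x) \<le> ln (exp (real x))"
    using x by (subst ln_le_cancel_iff) auto
  then have "ln (real x ^ x / fact x) \<le> real x" by simp
  then have 1: "real x * ln (real x) - real x \<le> ln (fact x)"
    using x by (simp add: ln_div ln_realpow)
  have "ln (fact x) \<le> (\<Sum>n=1..x. (mangoldt n :: real) * (real x / real n))"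
    unfolding ln_fact_eq_sum_mangoldt
    by (intro sum_mono mult_left_mono of_nat_div_le_of_nat mangoldt_nonneg)
  also have "\<dots> = real x * (\<Sum>n=1..x. (mangoldt n :: real) / real n)"
    by (simp add: sum_distrib_left mult_ac)
  finally have "real x * (ln (real x) - 1) \<le> real x * (\<Sum>n=1..x. (mangoldt n :: real) / real n)"
    using 1 by (simp add: algebra_simps)
  then show ?thesis using x by simp
qed

section \<open>Nonvanishing at 1 of the L-series of a real character\<close>

text \<open>Stands for a nonprincipal real Dirichlet character: periodicity and nonprincipality
  enter the analysis through the bound on the partial sums.\<close>

locale bounded_real_character =
  fixes \<psi> :: "nat \<Rightarrow> real" and C :: real
  assumes mult: "\<psi> (a * b) = \<psi> a * \<psi> b"
    and one: "\<psi> 1 = 1"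
    and range: "\<psi> n \<in> {-1, 0, 1}"
    and sum_bound: "\<bar>\<Sum>n=1..x. \<psi> n\<bar> \<le> C"
begin

lemma C_nonneg: "0 \<le> C"
  using sum_bound[of 0] by simp

lemma power: "\<psi> (a ^ k) = \<psi> a ^ k"
  by (induction k) (use one mult in auto)

lemma abs_le_1: "\<bar>\<psi> n\<bar> \<le> 1"
  using range[of n] by auto

text \<open>The factor 2 arises because a block from m to k is a difference of two initial segments,
  each bounded by C.\<close>

lemma weighted_sum_bound:
  assumes "1 \<le> m" and "\<And>n. m \<le> n \<Longrightarrow> b (Suc n) \<le> b n" and "\<And>n. m \<le> n \<Longrightarrow> 0 \<le> b n"
  shows "\<bar>\<Sum>n=m..k. \<psi> n * b n\<bar> \<le> 2 * C * b m"
proof (rule abel_bound)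
  fix k assume "m \<le> k"
  then have "(\<Sum>n=1..k. \<psi> n) = (\<Sum>n=1..m-1. \<psi> n) + (\<Sum>n=m..k. \<psi> n)"
    using assms(1) sum.ub_add_nat[of 1 "m - 1" \<psi> "k - (m - 1)"] by simp
  then show "\<bar>\<Sum>n=m..k. \<psi> n\<bar> \<le> 2 * C"
    using sum_bound[of k] sum_bound[of "m - 1"] by linarith
qed (use assms C_nonneg in auto)

definition L_partial :: "nat \<Rightarrow> real" where
  "L_partial x = (\<Sum>n=1..x. \<psi> n / n)"

definition L_one :: real where
  "L_one = lim L_partial"

lemma L_partial_diff:
  assumes "x \<le> y"
  shows "\<bar>L_partial y - L_partial x\<bar> \<le> 2 * C / (real x + 1)"
proof -
  have "L_partial y - L_partial x = (\<Sum>n=x+1..y. \<psi> n * (1 / real n))"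
    using assms sum.ub_add_nat[of 1 x "\<lambda>n. \<psi> n / real n" "y - x"] by (simp add: L_partial_def)
  also have "\<bar>\<dots>\<bar> \<le> 2 * C * (1 / real (x + 1))"
    by (rule weighted_sum_bound) (auto simp: field_simps)
  finally show ?thesis by (simp add: add.commute)
qed

lemma L_partial_tendsto: "L_partial \<longlonglongrightarrow> L_one"
proof -
  have "Cauchy L_partial"
  proof (rule CauchyI')
    fix e :: real assume "0 < e"
    obtain M :: nat where M: "2 * C / e < real M" using reals_Archimedean2 by blast
    have "dist (L_partial m) (L_partial n) < e" if "M \<le> m" "m < n" for m n
    proof -
      have "\<bar>L_partial n - L_partial m\<bar> \<le> 2 * C / (real m + 1)"
        using that by (intro L_partial_diff) simp
      also have "\<dots> < e"
      proof -
        have "2 * C / e < real m + 1" using M that by simp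
        then show ?thesis using \<open>0 < e\<close> by (simp add: field_simps)
      qed
      finally show ?thesis by (simp add: dist_real_def abs_minus_commute)
    qed
    then show "\<exists>M. \<forall>m\<ge>M. \<forall>n>m. dist (L_partial m) (L_partial n) < e" by blast
  qed
  then show ?thesis
    unfolding L_one_def using Cauchy_convergent convergent_LIMSEQ_iff by blast
qed

lemma L_partial_error: "\<bar>L_partial x - L_one\<bar> \<le> 2 * C / (real x + 1)"
proof (rule tendsto_upperbound)
  show "(\<lambda>y. \<bar>L_partial x - L_partial y\<bar>) \<longlonglongrightarrow> \<bar>L_partial x - L_one\<bar>"
    by (intro tendsto_intros L_partial_tendsto)
  show "\<forall>\<^sub>F y in sequentially. \<bar>L_partial x - L_partial y\<bar> \<le> 2 * C / (real x + 1)"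
    using eventually_ge_at_top[of x] by eventually_elim (metis L_partial_diff abs_minus_commute)
qed simp

section \<open>Divisor sums of a real character\<close>

definition divisor_sum :: "nat \<Rightarrow> real" where
  "divisor_sum n = (\<Sum>d | d dvd n. \<psi> d)"

lemma divisor_sum_coprime:
  assumes "coprime a b" "a > 0" "b > 0"
  shows "divisor_sum (a * b) = divisor_sum a * divisor_sum b"
proof -
  have "inj_on (\<lambda>(x, y). x * y) ({d. d dvd a} \<times> {d. d dvd b})"
  proof (rule inj_onI, clarsimp)
    fix x y x' y' assume d: "x dvd a" "y dvd b" "x' dvd a" "y' dvd b" and e: "x * y = x' * y'"
    have "coprime x y'" "coprime x' y"
      using d assms(1) by (meson coprime_divisors)+
    then have "x dvd x'" "x' dvd x" 
      using e by (metis coprime_dvd_mult_left_iff dvd_triv_left)+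
    then have "x = x'" by (rule dvd_antisym)
    moreover have "x > 0" using d assms(2) by (meson dvd_pos_nat)
    ultimately show "x = x' \<and> y = y'" using e by simp
  qed
  moreover have "(\<lambda>(x, y). x * y) ` ({d. d dvd a} \<times> {d. d dvd b}) = {d. d dvd a * b}"
  proof (intro equalityI subsetI)
    fix d assume "d \<in> {d. d dvd a * b}"
    then obtain x y where "d = x * y" "x dvd a" "y dvd b" using division_decomp[of d a b] by auto
    then show "d \<in> (\<lambda>(x, y). x * y) ` ({d. d dvd a} \<times> {d. d dvd b})" by force
  qed (auto intro: mult_dvd_mono)
  ultimately have "divisor_sum (a * b) = (\<Sum>(x, y)\<in>{d. d dvd a} \<times> {d. d dvd b}. \<psi> (x * y))"
    unfolding divisor_sum_def by (subst sum.reindex_bij_betw[symmetric, of "\<lambda>(x, y). x * y"])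
      (auto simp: bij_betw_def case_prod_unfold)
  also have "\<dots> = divisor_sum a * divisor_sum b"
    unfolding divisor_sum_def by (simp add: mult sum_product sum.cartesian_product)
  finally show ?thesis .
qed

text \<open>The divisor sum at \<open>p ^ k\<close> is a geometric sum of ratio -1, 0 or 1; it can
  vanish only for ratio -1 and odd k.\<close>

lemma divisor_sum_prime_power:
  assumes "prime p"
  shows "divisor_sum (p ^ k) \<ge> 0" "divisor_sum (p ^ (2 * k)) \<ge> 1"
proof -
  have eq: "divisor_sum (p ^ k) = (\<Sum>i\<le>k. \<psi> p ^ i)" for k
  proof -
    have "{d. d dvd p ^ k} = (\<lambda>i. p ^ i) ` {..k}"
      using divides_primepow_nat[OF assms] by auto
    moreover have "inj_on (\<lambda>i. p ^ i) {..k}"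
      using assms by (auto intro!: inj_onI dest: prime_power_inj)
    ultimately show ?thesis
      unfolding divisor_sum_def by (simp add: sum.reindex power)
  qed
  have s: "(\<Sum>i\<le>k. (-1 :: real) ^ i) = (if even k then 1 else 0)" for k :: nat
    by (induction k) auto
  have z: "(\<Sum>i\<le>k. (0 :: real) ^ i) = 1" for k :: nat
    by (induction k) auto
  show "divisor_sum (p ^ k) \<ge> 0" "divisor_sum (p ^ (2 * k)) \<ge> 1"
    using range[of p] by (auto simp: eq s z)
qed

text \<open>Multiplicativity reduces both claims to prime powers; the induction splits off the full
  power of one prime.\<close>

lemma divisor_sum_nonneg: "n > 0 \<Longrightarrow> divisor_sum n \<ge> 0"
  and divisor_sum_square: "n > 0 \<Longrightarrow> divisor_sum (n ^ 2) \<ge> 1"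
proof (induction n rule: less_induct)
  case (less n)
  {
    assume "n > 0"
    have "divisor_sum n \<ge> 0 \<and> divisor_sum (n ^ 2) \<ge> 1"
    proof (cases "n = 1")
      case True
      then show ?thesis using one by (simp add: divisor_sum_def)
    next
      case False
      then obtain p where p: "prime p" "p dvd n" using prime_factor_nat by blast
      define k where "k = multiplicity p n"
      have "\<not> is_unit p" using p by (metis not_prime_unit)
      then obtain m where m: "n = p ^ k * m" "\<not> p dvd m"
        using multiplicity_decompose'[of n p] \<open>n > 0\<close> unfolding k_def by auto
      have "k > 0" using m p by (metis gr0I mult_1 power_0)
      have "m > 0" using m \<open>n > 0\<close> by (auto intro: gr0I)
      have "p ^ k > 1" using \<open>k > 0\<close> prime_gt_1_nat[OF p(1)] by (rule one_less_power[rotated])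
      then have "m < n" using m \<open>m > 0\<close> by simp
      have cop: "coprime (p ^ k) m" using p m by (simp add: prime_imp_coprime)
      have cop2: "coprime (p ^ (2 * k)) (m ^ 2)" using p m by (simp add: prime_imp_coprime)
      have sq: "n ^ 2 = p ^ (2 * k) * m ^ 2" using m by (simp add: power_mult_distrib power_mult mult.commute[of 2])
      have "p > 0" using p prime_gt_0_nat by blast
      have "divisor_sum n = divisor_sum (p ^ k) * divisor_sum m"
        using m(1) divisor_sum_coprime[OF cop] \<open>p > 0\<close> \<open>m > 0\<close> by simp
      moreover have "divisor_sum (n ^ 2) = divisor_sum (p ^ (2 * k)) * divisor_sum (m ^ 2)"
        using sq divisor_sum_coprime[OF cop2] \<open>p > 0\<close> \<open>m > 0\<close> by simp
      ultimately show ?thesis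
        using less.IH[OF \<open>m < n\<close> \<open>m > 0\<close>] less.IH(2)[OF \<open>m < n\<close> \<open>m > 0\<close>]
          divisor_sum_prime_power[OF p(1), of k]
          mult_mono[of 1 "divisor_sum (p ^ (2 * k))" 1 "divisor_sum (m ^ 2)"] by auto
    qed
  }
  then show "n > 0 \<Longrightarrow> divisor_sum n \<ge> 0" "n > 0 \<Longrightarrow> divisor_sum (n ^ 2) \<ge> 1" by auto
qed

end

text \<open>Pair the terms of index i and n-1-i: their geometric mean is \<open>r ^ (n - 1)\<close>,
  so their sum is at least twice that.\<close>

lemma sum_power_ge:
  fixes r :: real
  assumes "0 < r"
  shows "real n * r ^ (n - 1) \<le> (\<Sum>i<n. (r ^ 2) ^ i)"
proof -
  have "2 * (\<Sum>i<n. (r ^ 2) ^ i) = (\<Sum>i<n. (r ^ 2) ^ i) + (\<Sum>i<n. (r ^ 2) ^ (n - Suc i))"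
    by (simp add: sum.nat_diff_reindex)
  also have "\<dots> = (\<Sum>i<n. (r ^ i) ^ 2 + (r ^ (n - Suc i)) ^ 2)"
    by (simp add: sum.distrib power_mult[symmetric] mult.commute)
  also have "\<dots> \<ge> (\<Sum>i<n. 2 * r ^ (n - 1))"
  proof (rule sum_mono)
    fix i assume "i \<in> {..<n}"
    then have "r ^ (n - 1) = r ^ i * r ^ (n - Suc i)" by (simp add: power_add[symmetric])
    then show "2 * r ^ (n - 1) \<le> (r ^ i) ^ 2 + (r ^ (n - Suc i)) ^ 2"
      using sum_squares_bound[of "r ^ i" "r ^ (n - Suc i)"] by simp
  qed
  finally show ?thesis by simp
qed

text \<open>
  Monsky's argument: \<open>L(1) = 0\<close> would bound \<open>\<Sum>\<^sub>n \<psi>(n) t\<^bsup>n\<^esup> / (1 - t\<^bsup>n\<^esup>) = \<Sum>\<^sub>n (\<Sum>\<^bsub>d dvd n\<^esub> \<psi>(d)) t\<^bsup>n\<^esup>\<close> as \<open>t\<close> tends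
  to 1, by partial summation against the following decreasing weight, although the squares alone
  make the right-hand side unbounded.
\<close>

lemma monsky_weight:
  fixes t :: real
  defines "b \<equiv> \<lambda>n. 1 / (real n * (1 - t)) - t ^ n / (1 - t ^ n)"
  assumes t: "0 < t" "t < 1" and n: "1 \<le> n"
  shows "b (Suc n) \<le> b n" "0 \<le> b n"
proof -
  define s where "s n = (\<Sum>i<n. t ^ i)" for n
  have geo: "1 - t ^ n = (1 - t) * s n" for n
    unfolding s_def by (rule one_diff_power_eq)
  have b: "b n = (1 / real n - t ^ n / s n) / (1 - t)" for n
    using t unfolding b_def geo by (simp add: diff_divide_distrib)
  have s_pos: "s n > 0" "s (Suc n) > 0"
    unfolding s_def using t n by (auto intro!: sum_pos simp: lessThan_empty_iff bot_nat_def simp del: sum.lessThan_Suc)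
  have s_Suc: "s (Suc n) = 1 + t * s n"
    unfolding s_def sum.lessThan_Suc_shift by (simp add: sum_distrib_left)
  \<comment> \<open>Without the factor 1/(1-t), the decrease of \<open>b\<close> amounts to n (n+1)
    t^n \<le> \<open>s n * s (Suc n)\<close>. Both factors on the right are estimated by
    \<open>sum_power_ge\<close> at the square root of t.\<close>
  have sqrt_t: "(sqrt t) ^ 2 = t" "0 < sqrt t" "sqrt t < 1" using t by auto
  have s1: "real n * sqrt t ^ (n - 1) \<le> s n" "real (Suc n) * sqrt t ^ n \<le> s (Suc n)"
    using sum_power_ge[of "sqrt t" n] sum_power_ge[of "sqrt t" "Suc n"] sqrt_t
    by (auto simp: s_def)
  have "real n * real (Suc n) * t ^ n = (real n * sqrt t ^ n) * (real (Suc n) * sqrt t ^ n)"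
    using sqrt_t by (simp add: power_mult_distrib[symmetric] power2_eq_square)
  also have "\<dots> \<le> s n * s (Suc n)"
  proof (rule mult_mono)
    have "sqrt t ^ n \<le> sqrt t ^ (n - 1)" using sqrt_t by (intro power_decreasing) auto
    then have "real n * sqrt t ^ n \<le> real n * sqrt t ^ (n - 1)" by (intro mult_left_mono) auto
    with s1 show "real n * sqrt t ^ n \<le> s n" by linarith
  qed (use s1 s_pos sqrt_t in auto)
  finally have key: "real n * real (Suc n) * t ^ n \<le> s n * s (Suc n)" .
  have "t ^ n / s n - t ^ Suc n / s (Suc n) = t ^ n / (s n * s (Suc n))"
    using s_pos by (simp add: field_simps s_Suc)
  also have "\<dots> \<le> 1 / (real n * real (Suc n))"
    using key s_pos n by (simp add: divide_le_eq le_divide_eq mult_ac)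
  also have "\<dots> = 1 / real n - 1 / real (Suc n)"
    using n by (simp add: field_simps)
  finally have "1 / real (Suc n) - t ^ Suc n / s (Suc n) \<le> 1 / real n - t ^ n / s n" by linarith
  then show "b (Suc n) \<le> b n"
    unfolding b using t by (intro divide_right_mono) auto
  have "real n * t ^ n \<le> s n"
    unfolding s_def using t sum_mono[of "{..<n}" "\<lambda>i. t ^ n" "\<lambda>i. t ^ i"]
    by (auto intro: power_decreasing)
  then have "t ^ n / s n \<le> 1 / real n" using s_pos n by (simp add: field_simps)
  then show "0 \<le> b n" unfolding b using t by simp
qed

text \<open>From n to n+1 the logarithm grows by at most 1/n, and ln n \<ge> 1 since e \<le>
  3.\<close>

lemma ln_over_antimono:
  assumes "3 \<le> n"
  shows "ln (real (Suc n)) / real (Suc n) \<le> ln (real n) / real n"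
proof -
  have ratio: "1 + 1 / real n = real (Suc n) / real n" using assms by (simp add: field_simps)
  have "ln (real (Suc n) / real n) = ln (real (Suc n)) - ln (real n)"
    by (rule ln_divide_pos) (use assms in simp_all)
  then have increment: "ln (real (Suc n)) - ln (real n) \<le> 1 / real n"
    unfolding ratio[symmetric] using ln_add_one_self_le_self[of "1 / real n"] by simp
  have "real n * (ln (real (Suc n)) - ln (real n)) \<le> real n * (1 / real n)"
    using increment by (rule mult_left_mono) simp
  moreover have "1 \<le> ln (real n)"
    using assms exp_le by (subst ln_ge_iff) auto
  ultimately show ?thesis using assms by (simp add: field_simps)
qed

context bounded_real_character
begin

text \<open>Keeping only exponents up to N, each geometric sum splits into 1/(d (1-t)), which
  produces \<open>L_partial N\<close>, the Monsky weight \<open>b d\<close>, which contributes at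
  most \<open>C * b 1 = C\<close>, and the missing tail \<open>e d\<close>, which starts at the
  first multiple of d beyond N.\<close>

lemma lambert_bound:
  fixes t :: real
  assumes t: "0 < t" "t < 1"
  shows "(\<Sum>n=1..N. divisor_sum n * t ^ n) \<le>
    C + \<bar>L_partial N\<bar> / (1 - t) + real N * t ^ (N + 1) / (1 - t)"
proof -
  define b where "b = (\<lambda>n. 1 / (real n * (1 - t)) - t ^ n / (1 - t ^ n))"
  define e where "e = (\<lambda>n. t ^ (n * (N div n + 1)) / (1 - t ^ n))"
  have "(\<Sum>n=1..N. divisor_sum n * t ^ n) =
      (\<Sum>n=1..N. \<Sum>d | d dvd n. \<psi> d * t ^ (d * (n div d)))"
    by (intro sum.cong refl) (auto simp: divisor_sum_def sum_distrib_right intro!: sum.cong)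
  also have "\<dots> = (\<Sum>d=1..N. \<Sum>k=1..N div d. \<psi> d * t ^ (d * k))"
    by (rule divisor_sum_swap)
  also have "\<dots> = (\<Sum>d=1..N. (\<psi> d / real d) / (1 - t) - \<psi> d * b d - \<psi> d * e d)"
  proof (rule sum.cong)
    fix d assume d: "d \<in> {1..N}"
    have lt: "t ^ d < 1" using t d power_decreasing[of 1 d t] by simp
    have "(\<Sum>k=1..M. y ^ k) * (1 - y) = y - y ^ (M + 1)" for M and y :: real
    proof (induction M)
      case (Suc M)
      then show ?case by (simp add: distrib_right) (simp add: algebra_simps)
    qed simp
    then have "(\<Sum>k=1..M. (t ^ d) ^ k) = ((t ^ d) - (t ^ d) ^ (M + 1)) / (1 - t ^ d)" for M
      using lt by (simp add: eq_divide_eq)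
    then have "(\<Sum>k=1..N div d. t ^ (d * k)) = (t ^ d - t ^ (d * (N div d + 1))) / (1 - t ^ d)"
      by (simp add: power_mult power_add)
    also have "\<dots> = 1 / (real d * (1 - t)) - b d - e d"
      unfolding b_def e_def by (simp add: diff_divide_distrib)
    finally have geo: "(\<Sum>k=1..N div d. t ^ (d * k)) = 1 / (real d * (1 - t)) - b d - e d" .
    show "(\<Sum>k=1..N div d. \<psi> d * t ^ (d * k)) =
        (\<psi> d / real d) / (1 - t) - \<psi> d * b d - \<psi> d * e d"
      unfolding sum_distrib_left[symmetric] geo by (simp add: right_diff_distrib)
  qed simp
  also have "\<dots> = L_partial N / (1 - t) - (\<Sum>d=1..N. \<psi> d * b d) - (\<Sum>d=1..N. \<psi> d * e d)"
    unfolding L_partial_def by (simp add: sum_subtractf sum_divide_distrib)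
  also have "\<dots> \<le> \<bar>L_partial N\<bar> / (1 - t) + C + real N * t ^ (N + 1) / (1 - t)"
  proof -
    have "\<bar>\<Sum>d=1..N. \<psi> d * b d\<bar> \<le> C * b 1"
    proof (rule abel_bound)
      show "b (Suc n) \<le> b n" "0 \<le> b n" if "1 \<le> n" for n
        using monsky_weight[OF t that] by (simp_all add: b_def)
    qed (use sum_bound C_nonneg in auto)
    moreover have "b 1 = 1" using t by (simp add: b_def field_simps)
    ultimately have 1: "- (\<Sum>d=1..N. \<psi> d * b d) \<le> C" by simp
    have "\<bar>\<Sum>d=1..N. \<psi> d * e d\<bar> \<le> (\<Sum>d=1..N. t ^ (N + 1) / (1 - t))"
    proof (rule order_trans[OF sum_abs sum_mono])
      fix d assume d: "d \<in> {1..N}"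
      have "N + 1 \<le> d * (N div d + 1)"
        using d dividend_less_times_div[of d N] by simp
      then have p: "t ^ (d * (N div d + 1)) \<le> t ^ (N + 1)" using t by (intro power_decreasing) auto
      have q: "t ^ d \<le> t" using t d power_decreasing[of 1 d t] by auto
      have "\<bar>\<psi> d * e d\<bar> \<le> 1 * \<bar>e d\<bar>"
        unfolding abs_mult by (intro mult_right_mono abs_le_1) auto
      also have "\<bar>e d\<bar> = t ^ (d * (N div d + 1)) / (1 - t ^ d)"
        using t q unfolding e_def by simp
      also have "\<dots> \<le> t ^ (N + 1) / (1 - t)"
        using p q t by (intro frac_le) auto
      finally show "\<bar>\<psi> d * e d\<bar> \<le> t ^ (N + 1) / (1 - t)" by simp
    qed
    then have "- (\<Sum>d=1..N. \<psi> d * e d) \<le> real N * t ^ (N + 1) / (1 - t)" by simp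
    moreover have "L_partial N / (1 - t) \<le> \<bar>L_partial N\<bar> / (1 - t)"
      using t by (intro divide_right_mono) auto
    ultimately show ?thesis using 1 by linarith
  qed
  finally show ?thesis by simp
qed

theorem L_one_nonzero: "L_one \<noteq> 0"
proof
  assume L0: "L_one = 0"
  obtain K :: nat where K: "2 * C < real K" using reals_Archimedean2 by blast
  have "K \<ge> 1" using K C_nonneg by (auto intro: Suc_leI gr0I)
  \<comment> \<open>By Bernoulli's inequality this t satisfies t^(K^2) \<ge> 1/2, so the K squares
    up to K^2 contribute at least K/2. With t fixed and N tending to infinity,
    \<open>lambert_bound\<close> and L(1) = 0 give K/2 \<le> C, against the choice of K.\<close>
  define t :: real where "t = 1 - 1 / (2 * real (K ^ 2))"
  have K2: "1 \<le> real (K ^ 2)" using \<open>K \<ge> 1\<close> by simp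
  have "1 < 2 * real (K ^ 2)" using K2 by linarith
  then have t: "0 < t" "t < 1" using \<open>K \<ge> 1\<close> by (simp_all add: t_def divide_less_eq)
  have tK: "1 / 2 \<le> t ^ (K ^ 2)"
    using Bernoulli_inequality[of "- 1 / (2 * real (K ^ 2))" "K ^ 2"] t(1) \<open>K \<ge> 1\<close>
    by (simp add: t_def)
  have lower: "real K / 2 \<le> (\<Sum>n=1..N. divisor_sum n * t ^ n)" if N: "K ^ 2 \<le> N" for N
  proof -
    have "real K / 2 = (\<Sum>k=1..K. 1 / 2)" by simp
    also have "\<dots> \<le> (\<Sum>k=1..K. divisor_sum (k ^ 2) * t ^ (k ^ 2))"
    proof (rule sum_mono)
      fix k assume k: "k \<in> {1..K}"
      have "t ^ (K ^ 2) \<le> t ^ (k ^ 2)"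
        using t k by (intro power_decreasing power_mono) auto
      moreover have "1 * t ^ (k ^ 2) \<le> divisor_sum (k ^ 2) * t ^ (k ^ 2)"
        using k t by (intro mult_right_mono divisor_sum_square) auto
      ultimately show "1 / 2 \<le> divisor_sum (k ^ 2) * t ^ (k ^ 2)" using tK by linarith
    qed
    also have "\<dots> = (\<Sum>n\<in>(\<lambda>k. k ^ 2) ` {1..K}. divisor_sum n * t ^ n)"
      by (subst sum.reindex) (auto intro!: inj_onI)
    also have "\<dots> \<le> (\<Sum>n=1..N. divisor_sum n * t ^ n)"
    proof (rule sum_mono2)
      show "(\<lambda>k. k ^ 2) ` {1..K} \<subseteq> {1..N}"
        using N by (auto intro: order_trans[OF power_mono])
    qed (use t divisor_sum_nonneg in auto)
    finally show ?thesis .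
  qed
  have "(\<lambda>N. C + \<bar>L_partial N\<bar> / (1 - t) + t * (real N * t ^ N) / (1 - t))
      \<longlonglongrightarrow> C + \<bar>L_one\<bar> / (1 - t) + t * 0 / (1 - t)"
    using t by (intro tendsto_intros L_partial_tendsto powser_times_n_limit_0) auto
  then have "(\<lambda>N. C + \<bar>L_partial N\<bar> / (1 - t) + t * (real N * t ^ N) / (1 - t)) \<longlonglongrightarrow> C"
    using L0 by simp
  then have "real K / 2 \<le> C"
  proof (rule tendsto_lowerbound)
    show "\<forall>\<^sub>F N in sequentially.
        real K / 2 \<le> C + \<bar>L_partial N\<bar> / (1 - t) + t * (real N * t ^ N) / (1 - t)"
      using eventually_ge_at_top[of "K ^ 2"]
    proof eventually_elim
      case (elim N)
      have *: "real N * t ^ (N + 1) = t * (real N * t ^ N)" by simp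
      show ?case using order_trans[OF lower[OF elim] lambert_bound[OF t, of N]] unfolding * .
    qed
  qed simp
  with K show False by simp
qed

text \<open>As ln n / n decreases only from n = 3 on, the terms at 1 and 2 are split off before
  summing by parts.\<close>

lemma sum_ln_bound: "\<bar>\<Sum>n=1..x. \<psi> n * (ln (real n) / real n)\<bar> \<le> 1 + 2 * C"
proof -
  define f where "f = (\<lambda>n. \<psi> n * (ln (real n) / real n))"
  have f1: "f (Suc 0) = 0" by (simp add: f_def)
  have ln2: "0 < ln (2 :: real)" "ln (2 :: real) < 1" using ln_2_less_1 by auto
  have f2: "\<bar>f 2\<bar> \<le> 1"
    using abs_le_1[of 2] ln2 mult_mono[of "\<bar>\<psi> 2\<bar>" 1 "ln 2 / 2" 1] by (simp add: f_def abs_mult)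
  consider "x = 0" | "x = 1" | "x \<ge> 2" by linarith
  then show ?thesis
  proof cases
    case 3
    then have "(\<Sum>n=1..x. f n) = f 2 + (\<Sum>n=3..x. f n)"
      using sum.atLeast_Suc_atMost[of 1 x f] sum.atLeast_Suc_atMost[of 2 x f] f1
      by (simp add: eval_nat_numeral)
    moreover have "\<bar>\<Sum>n=3..x. f n\<bar> \<le> 2 * C * (ln (real 3) / real 3)"
      unfolding f_def by (rule weighted_sum_bound) (use ln_over_antimono in auto)
    moreover have "2 * C * (ln (real 3) / real 3) \<le> 2 * C * 1"
      using C_nonneg ln_le_minus_one[of 3] by (intro mult_left_mono) auto
    ultimately show ?thesis using f2 unfolding f_def by linarith
  qed (use C_nonneg f1 in \<open>auto simp: f_def\<close>)
qed

text \<open>Expanding ln n over the divisors of n gives the sum of \<psi>(d) \<Lambda>(d) / d times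
  \<open>L_partial (x div d)\<close>. Replacing the last factor by its limit costs at most 8 C by
  Chebyshev's bound, and the nonzero \<open>L_one\<close> can then be divided out.\<close>

theorem sum_mangoldt_bounded: "\<exists>B. \<forall>x. \<bar>\<Sum>n=1..x. \<psi> n * (mangoldt n / real n)\<bar> \<le> B"
proof (intro exI allI)
  fix x
  define S where "S = (\<Sum>n=1..x. \<psi> n * (mangoldt n / real n))"
  have "(\<Sum>n=1..x. \<psi> n * (ln (real n) / real n)) =
      (\<Sum>n=1..x. \<Sum>d | d dvd n. (\<psi> d * (mangoldt d / real d)) * (\<psi> (n div d) / real (n div d)))"
  proof (rule sum.cong)
    fix n assume n: "n \<in> {1..x}"
    have "(\<psi> d * (mangoldt d / real d)) * (\<psi> (n div d) / real (n div d)) = \<psi> n / real n * mangoldt d"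
      if "d dvd n" for d
    proof -
      from that obtain k where "n = d * k" by blast
      then show ?thesis using n by (auto simp: mult)
    qed
    then have "(\<Sum>d | d dvd n. (\<psi> d * (mangoldt d / real d)) * (\<psi> (n div d) / real (n div d))) =
        \<psi> n / real n * (\<Sum>d | d dvd n. mangoldt d)"
      by (simp add: sum_distrib_left)
    then show "\<psi> n * (ln (real n) / real n) =
        (\<Sum>d | d dvd n. (\<psi> d * (mangoldt d / real d)) * (\<psi> (n div d) / real (n div d)))"
      using n by (simp add: mangoldt_sum)
  qed simp
  also have "\<dots> = (\<Sum>d=1..x. \<Sum>e=1..x div d. (\<psi> d * (mangoldt d / real d)) * (\<psi> e / real e))"
    by (rule divisor_sum_swap)
  also have "\<dots> = (\<Sum>d=1..x. (\<psi> d * (mangoldt d / real d)) * L_partial (x div d))"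
    by (simp add: L_partial_def sum_distrib_left)
  also have "\<dots> = S * L_one + (\<Sum>d=1..x. (\<psi> d * (mangoldt d / real d)) * (L_partial (x div d) - L_one))"
    unfolding S_def by (simp add: right_diff_distrib sum_subtractf sum_distrib_right)
  finally have main: "(\<Sum>n=1..x. \<psi> n * (ln (real n) / real n)) =
      S * L_one + (\<Sum>d=1..x. (\<psi> d * (mangoldt d / real d)) * (L_partial (x div d) - L_one))" .
  have "\<bar>\<Sum>d=1..x. (\<psi> d * (mangoldt d / real d)) * (L_partial (x div d) - L_one)\<bar> \<le>
      (\<Sum>d=1..x. mangoldt d * (2 * C / real x))"
  proof (rule order_trans[OF sum_abs sum_mono])
    fix d assume d: "d \<in> {1..x}"
    have "x \<le> d * (x div d + 1)"
      using d dividend_less_times_div[of d x] by simp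
    then have "real x \<le> real d * (real (x div d) + 1)"
      by (metis of_nat_mult of_nat_1 of_nat_add of_nat_mono)
    then have "2 * C / (real d * (real (x div d) + 1)) \<le> 2 * C / real x"
      using C_nonneg d by (intro divide_left_mono) auto
    moreover have "mangoldt d / real d * \<bar>L_partial (x div d) - L_one\<bar> \<le>
        mangoldt d / real d * (2 * C / (real (x div d) + 1))"
      using mangoldt_nonneg by (intro mult_left_mono L_partial_error) auto
    moreover have "\<bar>\<psi> d * (mangoldt d / real d)\<bar> \<le> 1 * (mangoldt d / real d)"
      unfolding abs_mult using abs_le_1 mangoldt_nonneg by (intro mult_mono) auto
    then have "\<bar>\<psi> d * (mangoldt d / real d) * (L_partial (x div d) - L_one)\<bar> \<le>
        mangoldt d / real d * \<bar>L_partial (x div d) - L_one\<bar>"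
      unfolding abs_mult[of "\<psi> d * (mangoldt d / real d)"] by (intro mult_right_mono) auto
    moreover have "mangoldt d * (2 * C / (real d * (real (x div d) + 1))) \<le> mangoldt d * (2 * C / real x)"
      using calculation(1) mangoldt_nonneg by (rule mult_left_mono)
    ultimately show "\<bar>\<psi> d * (mangoldt d / real d) * (L_partial (x div d) - L_one)\<bar> \<le>
        mangoldt d * (2 * C / real x)"
      by (simp add: mult_ac)
  qed
  also have "\<dots> = (\<Sum>d=1..x. mangoldt d) * (2 * C / real x)" by (rule sum_distrib_right[symmetric])
  also have "\<dots> \<le> 4 * real x * (2 * C / real x)"
    using C_nonneg by (intro mult_right_mono sum_mangoldt_le) auto
  also have "\<dots> \<le> 8 * C" using C_nonneg by simp
  finally have "\<bar>S * L_one\<bar> \<le> 1 + 10 * C" using main sum_ln_bound[of x] by linarith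
  then have "\<bar>S\<bar> * \<bar>L_one\<bar> \<le> 1 + 10 * C" by (simp add: abs_mult)
  then show "\<bar>S\<bar> \<le> (1 + 10 * C) / \<bar>L_one\<bar>"
    using L_one_nonzero by (simp add: field_simps)
qed

end

section \<open>Primes with prescribed values of real characters\<close>

text \<open>Controls the even prime powers, where real characters lose their sign. From ln(j^2) = 4
  ln(sqrt j) \<le> 4 sqrt j the terms are at most 4 j^(-3/2).\<close>

lemma mangoldt_square_sums_bounded:
  "\<exists>Z. \<forall>x. (\<Sum>n\<in>{n\<in>{1..x}. \<exists>j. n = j ^ 2}. (mangoldt n :: real) / real n) \<le> Z"
proof (intro exI allI)
  fix x :: nat
  have summable: "summable (\<lambda>j. 4 * real j powr (-3/2))"
    by (intro summable_mult) (simp add: summable_real_powr_iff)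
  have "{n\<in>{1..x}. \<exists>j. n = j ^ 2} \<subseteq> (\<lambda>j. j ^ 2) ` {1..x}"
  proof clarsimp
    fix j :: nat assume "Suc 0 \<le> j ^ 2" "j ^ 2 \<le> x"
    moreover have "j \<le> j ^ 2" by (cases j) (auto simp: power2_eq_square)
    moreover have "j \<noteq> 0" using \<open>Suc 0 \<le> j ^ 2\<close> by (cases j) auto
    ultimately show "j ^ 2 \<in> power2 ` {Suc 0..x}" by (intro imageI) simp
  qed
  then have "(\<Sum>n\<in>{n\<in>{1..x}. \<exists>j. n = j ^ 2}. (mangoldt n :: real) / real n) \<le>
      (\<Sum>n\<in>(\<lambda>j. j ^ 2) ` {1..x}. mangoldt n / real n)"
    by (intro sum_mono2) (auto simp: mangoldt_nonneg)
  also have "\<dots> = (\<Sum>j=1..x. mangoldt (j ^ 2) / real (j ^ 2))"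
    by (subst sum.reindex) (auto intro!: inj_onI)
  also have "\<dots> \<le> (\<Sum>j=1..x. 4 * real j powr (-3/2))"
  proof (rule sum_mono)
    fix j assume j: "j \<in> {1..x}"
    have "mangoldt (j ^ 2) \<le> ln (real (j ^ 2))" using j by (intro mangoldt_le) auto
    also have "\<dots> = 4 * ln (sqrt (real j))" using j by (simp add: ln_sqrt ln_realpow)
    also have "\<dots> \<le> 4 * sqrt (real j)"
      using j ln_le_minus_one[of "sqrt (real j)"] by simp
    finally have "mangoldt (j ^ 2) / real (j ^ 2) \<le> 4 * sqrt (real j) / real (j ^ 2)"
      by (rule divide_right_mono) simp
    also have "\<dots> = 4 * (real j powr (1/2) * real j powr (-2))"
      using j by (simp add: powr_half_sqrt powr_minus_divide)
    also have "\<dots> = 4 * real j powr (-3/2)" by (simp add: powr_add[symmetric])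
    finally show "mangoldt (j ^ 2) / real (j ^ 2) \<le> 4 * real j powr (-3/2)" .
  qed
  also have "\<dots> \<le> (\<Sum>j. 4 * real j powr (-3/2))"
    by (rule sum_le_suminf[OF summable]) auto
  finally show "(\<Sum>n\<in>{n\<in>{1..x}. \<exists>j. n = j ^ 2}. (mangoldt n :: real) / real n) \<le>
      (\<Sum>j. 4 * real j powr (-3/2))" .
qed

text \<open>Controls the powers of finitely many excluded primes, by comparison with the geometric
  series of ratio 1/2.\<close>

lemma prime_power_sum_le_one:
  fixes p :: nat
  assumes "2 \<le> p"
  shows "(\<Sum>n\<in>{n\<in>{1..x}. \<exists>k\<ge>1. n = p ^ k}. 1 / real n) \<le> 1"
proof -
  have "{n\<in>{1..x}. \<exists>k\<ge>1. n = p ^ k} \<subseteq> (\<lambda>k. p ^ k) ` {1..x}"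
  proof clarsimp
    fix k :: nat assume "Suc 0 \<le> k" "p ^ k \<le> x"
    moreover have "k < p ^ k" using assms by (intro less_exp[THEN less_le_trans] power_mono) auto
    ultimately show "p ^ k \<in> power p ` {Suc 0..x}" by (intro imageI) simp
  qed
  then have "(\<Sum>n\<in>{n\<in>{1..x}. \<exists>k\<ge>1. n = p ^ k}. 1 / real n) \<le>
      (\<Sum>n\<in>(\<lambda>k. p ^ k) ` {1..x}. 1 / real n)"
    by (intro sum_mono2) auto
  also have "\<dots> = (\<Sum>k=1..x. 1 / real (p ^ k))"
    using assms by (subst sum.reindex) (auto intro!: inj_onI)
  also have "\<dots> \<le> (\<Sum>k=1..x. (1 / 2) ^ k)"
  proof (rule sum_mono)
    fix k :: nat
    have "(2 :: real) ^ k \<le> real p ^ k" using assms by (intro power_mono) auto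
    then show "1 / real (p ^ k) \<le> (1 / 2) ^ k" using assms by (simp add: field_simps)
  qed
  also have "\<dots> = 1 - (1 / 2) ^ x" by (induction x) auto
  also have "\<dots> \<le> 1" by simp
  finally show ?thesis .
qed

lemma power_odd_sign:
  fixes s :: real
  assumes "s \<in> {-1, 0, 1}" "odd k"
  shows "s ^ k = s"
  using assms by (auto simp: odd_pos)

theorem prime_with_real_character_values:
  fixes \<psi> :: "'i \<Rightarrow> nat \<Rightarrow> real" and \<epsilon> :: "'i \<Rightarrow> real"
  assumes fin: "finite I" "finite F"
    and char: "\<And>S. S \<subseteq> I \<Longrightarrow> S \<noteq> {} \<Longrightarrow> \<exists>C. bounded_real_character (\<lambda>n. \<Prod>i\<in>S. \<psi> i n) C"
    and \<epsilon>: "\<And>i. i \<in> I \<Longrightarrow> \<epsilon> i \<in> {-1, 1}"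
  obtains p where "prime p" "p \<notin> F" "\<And>i. i \<in> I \<Longrightarrow> \<psi> i p \<noteq> - \<epsilon> i"
proof (rule ccontr)
  assume neg: "\<not> thesis"
  note witness = that
  define g where "g = (\<lambda>n. \<Prod>i\<in>I. \<epsilon> i * \<psi> i n + 1)"
  define F' where "F' = {p\<in>F. prime p}"
  have single: "\<exists>C. bounded_real_character (\<psi> i) C" if "i \<in> I" for i
    using char[of "{i}"] that by simp
  have range: "\<psi> i n \<in> {-1, 0, 1}" and pow: "\<psi> i (p ^ k) = \<psi> i p ^ k" if "i \<in> I" for i n p k
    using single[OF that] bounded_real_character.range bounded_real_character.power by blast+
  have factor: "0 \<le> \<epsilon> i * \<psi> i n + 1" "\<epsilon> i * \<psi> i n + 1 \<le> 2" if "i \<in> I" for i n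
    using range[OF that, of n] \<epsilon>[OF that] by auto
  have g_nonneg: "0 \<le> g n" for n unfolding g_def by (intro prod_nonneg factor)
  have g_le: "g n \<le> 2 ^ card I" for n
    unfolding g_def using factor by (intro prod_le_power) auto
  have g_prime: "g p = 0" if "prime p" "p \<notin> F" for p
  proof -
    from neg that witness[of p] obtain i where "i \<in> I" "\<psi> i p = - \<epsilon> i" by blast
    then have "\<epsilon> i * \<psi> i p + 1 = 0" using \<epsilon> by fastforce
    then show ?thesis unfolding g_def using \<open>i \<in> I\<close> fin by (intro prod_zero) auto
  qed
  define sq where "sq = (\<lambda>n. if \<exists>j. n = j ^ 2 then (mangoldt n :: real) / real n else 0)"
  define pp where "pp = (\<lambda>p n. if \<exists>k\<ge>1. n = p ^ k then ln (real p) * (1 / real n) else 0)"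
  have sq_nonneg: "0 \<le> sq n" for n by (auto simp: sq_def mangoldt_nonneg)
  have pp_nonneg: "0 \<le> pp p n" if "p \<in> F'" for p n
    using that prime_ge_1_nat by (auto simp: pp_def F'_def)
  have term_le: "g n * (mangoldt n / real n) \<le> 2 ^ card I * (sq n + (\<Sum>p\<in>F'. pp p n))" for n
  proof (cases "primepow n \<and> g n \<noteq> 0")
    case False
    then have "g n * (mangoldt n / real n) = 0" by (auto simp: mangoldt_def)
    moreover have "0 \<le> sq n + (\<Sum>p\<in>F'. pp p n)"
      using sq_nonneg pp_nonneg by (intro add_nonneg_nonneg sum_nonneg)
    ultimately show ?thesis by (metis mult_nonneg_nonneg zero_le_numeral zero_le_power)
  next
    case True
    then obtain p k where pk: "prime p" "k > 0" "n = p ^ k" by (auto simp: primepow_def)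
    have "mangoldt n / real n \<le> sq n + (\<Sum>p\<in>F'. pp p n)"
    proof (cases "even k")
      case True
      then have "\<exists>j. n = j ^ 2" using pk by (auto elim!: evenE simp: power_mult mult.commute intro: exI[of _ "p ^ (k div 2)"])
      then have "sq n = mangoldt n / real n" by (simp add: sq_def)
      then show ?thesis using pp_nonneg by (auto intro!: sum_nonneg)
    next
      case False
      \<comment> \<open>An odd power of -1, 0 or 1 is the number itself, so each \<psi> i agrees at
        n and p.\<close>
      have "g n = g p" unfolding g_def pk(3)
        using False range by (intro prod.cong refl) (simp add: pow power_odd_sign)
      then have "p \<in> F'" using True g_prime pk(1) by (auto simp: F'_def)
      moreover have "pp p n = mangoldt n / real n"
      proof -
        have "\<exists>k'\<ge>1. n = p ^ k'" using pk by (intro exI[of _ k]) auto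
        then show ?thesis using pk by (simp add: pp_def)
      qed
      ultimately have "mangoldt n / real n \<le> (\<Sum>p\<in>F'. pp p n)"
        using member_le_sum[of p F' "\<lambda>p. pp p n"] pp_nonneg fin by (simp add: F'_def)
      then show ?thesis using sq_nonneg[of n] by linarith
    qed
    then show ?thesis using g_le[of n] g_nonneg[of n] mangoldt_nonneg[of n] by (intro mult_mono) auto
  qed
  obtain Z where Z: "\<And>x. (\<Sum>n\<in>{n\<in>{1..x}. \<exists>j. n = j ^ 2}. (mangoldt n :: real) / real n) \<le> Z"
    using mangoldt_square_sums_bounded by blast
  define U where "U = 2 ^ card I * (Z + (\<Sum>p\<in>F'. ln (real p)))"
  have upper: "(\<Sum>n=1..x. g n * (mangoldt n / real n)) \<le> U" for x
  proof -
    have "(\<Sum>n=1..x. g n * (mangoldt n / real n)) \<le>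
        2 ^ card I * ((\<Sum>n=1..x. sq n) + (\<Sum>n=1..x. \<Sum>p\<in>F'. pp p n))"
      unfolding sum.distrib[symmetric] sum_distrib_left by (rule sum_mono) (rule term_le)
    also have "\<dots> \<le> U"
      unfolding U_def
    proof (intro mult_left_mono add_mono)
      show "(\<Sum>n=1..x. sq n) \<le> Z"
        using Z[of x] unfolding sq_def by (subst sum.inter_filter[symmetric]) auto
      show "(\<Sum>n=1..x. \<Sum>p\<in>F'. pp p n) \<le> (\<Sum>p\<in>F'. ln (real p))"
      proof (subst sum.swap, rule sum_mono)
        fix p assume p: "p \<in> F'"
        then have p2: "2 \<le> p" by (auto simp: F'_def prime_ge_2_nat)
        have "(\<Sum>n=1..x. pp p n) =
            ln (real p) * (\<Sum>n\<in>{n\<in>{1..x}. \<exists>k\<ge>1. n = p ^ k}. 1 / real n)"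
          unfolding pp_def sum_distrib_left by (subst sum.inter_filter[symmetric]) auto
        also have "\<dots> \<le> ln (real p) * 1"
          using p2 prime_power_sum_le_one[OF p2] by (intro mult_left_mono) auto
        finally show "(\<Sum>n=1..x. pp p n) \<le> ln (real p)" by simp
      qed
    qed auto
    finally show ?thesis .
  qed
  define c where "c = (\<lambda>S n. \<Prod>i\<in>S. \<psi> i n)"
  have "\<forall>S\<in>Pow I - {{}}. \<exists>B. \<forall>x. \<bar>\<Sum>n=1..x. c S n * (mangoldt n / real n)\<bar> \<le> B"
    using char bounded_real_character.sum_mangoldt_bounded unfolding c_def by blast
  then obtain B where B: "\<And>S x. S \<in> Pow I - {{}} \<Longrightarrow>
      \<bar>\<Sum>n=1..x. c S n * (mangoldt n / real n)\<bar> \<le> B S"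
    by metis
  have lower: "ln (real x) - 1 - (\<Sum>S\<in>Pow I - {{}}. B S) \<le>
      (\<Sum>n=1..x. g n * (mangoldt n / real n))" if "x \<ge> 1" for x
  proof -
    \<comment> \<open>Expanding the product over I gives one term per subset S, carrying the product
      character \<open>c S\<close>.\<close>
    have "g n * w = (\<Sum>S\<in>Pow I. prod \<epsilon> S * (c S n * w))" for n w
      unfolding g_def c_def using fin
      by (simp add: prod_add prod.distrib sum_distrib_right mult.assoc)
    then have "(\<Sum>n=1..x. g n * (mangoldt n / real n)) =
        (\<Sum>n=1..x. \<Sum>S\<in>Pow I. prod \<epsilon> S * (c S n * (mangoldt n / real n)))"
      by (intro sum.cong refl)
    also have "\<dots> = (\<Sum>S\<in>Pow I. prod \<epsilon> S * (\<Sum>n=1..x. c S n * (mangoldt n / real n)))"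
      by (subst sum.swap) (simp only: sum_distrib_left)
    also have "\<dots> = (\<Sum>n=1..x. mangoldt n / real n) +
        (\<Sum>S\<in>Pow I - {{}}. prod \<epsilon> S * (\<Sum>n=1..x. c S n * (mangoldt n / real n)))"
      using fin by (subst sum.remove[of "Pow I" "{}"]) (auto simp: c_def)
    finally have eq: "(\<Sum>n=1..x. g n * (mangoldt n / real n)) = \<dots>" .
    have "(\<Sum>S\<in>Pow I - {{}}. - B S) \<le>
        (\<Sum>S\<in>Pow I - {{}}. prod \<epsilon> S * (\<Sum>n=1..x. c S n * (mangoldt n / real n)))"
    proof (rule sum_mono)
      fix S assume S: "S \<in> Pow I - {{}}"
      have "\<bar>prod \<epsilon> S\<bar> = (\<Prod>i\<in>S. 1)"
        unfolding abs_prod using S \<epsilon> by (intro prod.cong) fastforce+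
      then have "\<bar>prod \<epsilon> S * (\<Sum>n=1..x. c S n * (mangoldt n / real n))\<bar> \<le> B S"
        using B[OF S, of x] by (simp add: abs_mult)
      then show "- B S \<le> prod \<epsilon> S * (\<Sum>n=1..x. c S n * (mangoldt n / real n))" by linarith
    qed
    then show ?thesis
      unfolding eq using sum_mangoldt_div_ge[OF that] by (simp add: sum_negf)
  qed
  define y where "y = U + 2 + (\<Sum>S\<in>Pow I - {{}}. B S)"
  obtain x :: nat where x: "exp y < real x" using reals_Archimedean2 by blast
  then have "x \<ge> 1" using exp_gt_zero[of y] by (cases x) auto
  moreover have "y < ln (real x)" using x \<open>x \<ge> 1\<close> by (metis exp_gt_zero less_trans ln_exp ln_less_cancel_iff)
  ultimately show False using lower[of x] upper[of x] by (simp add: y_def)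
qed

section \<open>Legendre symbols\<close>

text \<open>Multiplication by a permutes the residues modulo M and changes the sign of \<psi>, so
  \<psi> sums to 0 over each period; only an incomplete period remains.\<close>

lemma bounded_real_characterI:
  fixes \<psi> :: "nat \<Rightarrow> real"
  assumes mult: "\<And>a b. \<psi> (a * b) = \<psi> a * \<psi> b" and one: "\<psi> 1 = 1"
    and range: "\<And>n. \<psi> n \<in> {-1, 0, 1}"
    and periodic: "\<And>n. \<psi> (n mod M) = \<psi> n" and "M > 0"
    and a: "coprime a M" "\<psi> a = -1"
  shows "bounded_real_character \<psi> (real M)"
proof
  fix x
  have abs_le: "\<bar>\<psi> n\<bar> \<le> 1" for n using range[of n] by auto
  have z: "\<psi> 0 = 0" using mult[of a 0] a by simp
  have "inj_on (\<lambda>n. a * n mod M) {..<M}"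
  proof (rule inj_onI)
    fix m n assume "m \<in> {..<M}" "n \<in> {..<M}" "a * m mod M = a * n mod M"
    then show "m = n" using a cong_mult_lcancel_nat[of a M m n] by (simp add: cong_def)
  qed
  moreover have "(\<lambda>n. a * n mod M) ` {..<M} \<subseteq> {..<M}" using \<open>M > 0\<close> by auto
  ultimately have "bij_betw (\<lambda>n. a * n mod M) {..<M} {..<M}"
    by (simp add: bij_betw_def endo_inj_surj)
  then have "(\<Sum>n<M. \<psi> n) = (\<Sum>n<M. \<psi> (a * n mod M))"
    by (rule sum.reindex_bij_betw[symmetric])
  also have "\<dots> = - (\<Sum>n<M. \<psi> n)" by (simp add: periodic mult a sum_negf)
  finally have period: "(\<Sum>n<M. \<psi> n) = 0" by simp
  have "(\<Sum>n\<in>{m * M..<m * M + M}. \<psi> n) = 0" for m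
  proof -
    have "(\<Sum>n\<in>{m * M..<m * M + M}. \<psi> n) = (\<Sum>n<M. \<psi> (n + m * M))"
      using sum.shift_bounds_nat_ivl[of \<psi> 0 "m * M" M] by (simp add: lessThan_atLeast0 add.commute)
    also have "\<dots> = (\<Sum>n<M. \<psi> n)"
      by (intro sum.cong refl) (metis periodic mod_mult_self1)
    finally show ?thesis using period by simp
  qed
  then have blocks: "(\<Sum>n<k * M. \<psi> n) = 0" for k
    unfolding sum.nat_group[symmetric] by simp
  define y where "y = Suc x"
  have "(\<Sum>n=1..x. \<psi> n) = (\<Sum>n<y. \<psi> n)"
    unfolding y_def sum.lessThan_Suc_shift using z
    by (simp add: sum.atLeast1_atMost_eq)
  also have "\<dots> = (\<Sum>n<y div M * M. \<psi> n) + (\<Sum>n\<in>{y div M * M..<y}. \<psi> n)"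
    by (simp add: lessThan_atLeast0 sum.atLeastLessThan_concat)
  also have "\<bar>\<dots>\<bar> \<le> (\<Sum>n\<in>{y div M * M..<y}. 1)"
    unfolding blocks by (simp only: add_0, intro order_trans[OF sum_abs] sum_mono abs_le)
  also have "\<dots> = real (y mod M)" by (simp add: minus_div_mult_eq_mod)
  also have "\<dots> \<le> real M" using \<open>M > 0\<close> by (simp add: less_imp_le)
  finally show "\<bar>\<Sum>n=1..x. \<psi> n\<bar> \<le> real M" .
qed (use assms in auto)

lemma Legendre_range: "Legendre a p \<in> {-1, 0, 1}"
  by (simp add: Legendre_def)

lemma Legendre_cong: "[a = b] (mod p) \<Longrightarrow> Legendre a p = Legendre b p"
  by (simp add: Legendre_def QuadRes_def cong_def)

text \<open>Two numbers in {-1, 0, 1} differ by at most 2, which is less than p.\<close>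

lemma Legendre_eqI:
  assumes "2 < p" "[Legendre a p = s] (mod p)" "s \<in> {-1, 0, 1}"
  shows "Legendre a p = s"
proof -
  have "\<bar>Legendre a p - s\<bar> < p" using assms Legendre_range[of a p] by auto
  moreover have "p dvd Legendre a p - s" using assms(2) by (simp add: cong_iff_dvd_diff)
  ultimately show ?thesis using zdvd_not_zless[of "\<bar>Legendre a p - s\<bar>" p] by auto
qed

lemma Legendre_mult:
  fixes p :: nat
  assumes p: "prime p" "2 < p"
  shows "Legendre (a * b) p = Legendre a p * Legendre b p"
proof (rule Legendre_eqI)
  have "[Legendre (a * b) p = a ^ ((p - 1) div 2) * b ^ ((p - 1) div 2)] (mod int p)"
    using euler_criterion[OF p, of "a * b"] by (simp add: power_mult_distrib)
  then show "[Legendre (a * b) p = Legendre a p * Legendre b p] (mod int p)"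
    using cong_mult[OF euler_criterion[OF p, of a] euler_criterion[OF p, of b]]
    by (meson cong_sym cong_trans)
  show "Legendre a p * Legendre b p \<in> {-1, 0, 1}"
    using Legendre_range[of a p] Legendre_range[of b p] by auto
qed (use p in auto)

lemma Legendre_1: "2 < p \<Longrightarrow> Legendre 1 p = 1"
  by (auto simp: Legendre_def QuadRes_def cong_def intro!: exI[of _ 1])

lemma Legendre_prod:
  fixes p :: nat
  assumes p: "prime p" "2 < p" and "finite A"
  shows "Legendre (\<Prod>i\<in>A. f i) p = (\<Prod>i\<in>A. Legendre (f i) p)"
  using assms(3) by (induction A rule: finite_induct) (use p in \<open>auto simp: Legendre_mult Legendre_1\<close>)

lemma Legendre_minus_1:
  fixes p :: nat
  assumes p: "prime p" "2 < p"
  shows "Legendre (-1) p = (if p mod 4 = 1 then 1 else -1)"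
proof (rule Legendre_eqI)
  have "odd p" using p prime_odd_nat by blast
  then have "even ((p - 1) div 2) \<longleftrightarrow> p mod 4 = 1" by presburger
  then show "[Legendre (-1) p = (if p mod 4 = 1 then 1 else -1)] (mod int p)"
    using euler_criterion[OF p, of "-1"] by (auto simp: uminus_power_if)
qed (use p in auto)

text \<open>In Gauss's lemma for the multiplier 2, with h = (p-1)/2, the products exceeding h are
  the doubles of the x with h/2 < x \<le> h; their number has a parity determined by p mod
  8.\<close>

lemma Legendre_2:
  fixes p :: nat
  assumes p: "prime p" "2 < p"
  shows "Legendre 2 p = (if p mod 8 = 1 \<or> p mod 8 = 7 then 1 else -1)"
proof -
  have "odd p" using p prime_odd_nat by blast
  interpret GAUSS p 2
    by unfold_locales (use p \<open>odd p\<close> in \<open>auto simp: cong_def\<close>)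
  define h where "h = (int p - 1) div 2"
  have ph: "int p = 2 * h + 1" using p_eq2 by (simp add: h_def)
  have "E = (\<lambda>x. 2 * x) ` {h div 2 <.. h}"
  proof (intro equalityI subsetI)
    fix y assume "y \<in> E"
    then obtain x where "0 < x" "x \<le> h" "y = x * 2 mod int p" "y > h"
      by (auto simp: E_def C_def B_def A_def h_def)
    moreover from this have "y = 2 * x" using ph by (simp add: mod_pos_pos_trivial)
    ultimately show "y \<in> (\<lambda>x. 2 * x) ` {h div 2 <.. h}" by (intro image_eqI[of _ _ x]) auto
  next
    fix y assume "y \<in> (\<lambda>x. 2 * x) ` {h div 2 <.. h}"
    then obtain x where x: "h div 2 < x" "x \<le> h" "y = 2 * x" by auto
    have "0 \<le> h" using ph p by simp
    then have "0 < x" "y > h" using x by auto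
    moreover have "y = x * 2 mod int p" using x ph \<open>0 < x\<close> by (simp add: mod_pos_pos_trivial)
    moreover have "x * 2 mod int p \<in> C"
      unfolding C_def B_def A_def using x \<open>0 < x\<close> by (intro imageI) (simp add: h_def)
    ultimately show "y \<in> E" by (simp add: E_def h_def)
  qed
  then have "card E = nat (h - h div 2)"
    by (simp add: card_image inj_on_def)
  moreover have "even (nat (h - h div 2)) \<longleftrightarrow> p mod 8 = 1 \<or> p mod 8 = 7"
  proof -
    have "0 \<le> h" using ph p by simp
    have "even (nat (h - h div 2)) \<longleftrightarrow> even (h - h div 2)"
      using \<open>0 \<le> h\<close> by (simp add: even_nat_iff)
    also have "\<dots> \<longleftrightarrow> h mod 4 = 0 \<or> h mod 4 = 3" by presburger
    also have "\<dots> \<longleftrightarrow> int p mod 8 = 1 \<or> int p mod 8 = 7" unfolding ph by presburger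
    also have "int p mod 8 = int (p mod 8)" by (simp add: zmod_int)
    finally show ?thesis by simp
  qed
  ultimately show ?thesis by (simp add: gauss_lemma)
qed

text \<open>Squaring identifies 1 and p-1, so on the finite set of nonzero residues it is not
  injective and hence not surjective.\<close>

lemma nonresidue_exists:
  fixes p :: nat
  assumes p: "prime p" "2 < p"
  obtains r :: nat where "Legendre (int r) p = -1"
proof -
  let ?A = "{1..<p}"
  let ?sq = "\<lambda>x. x ^ 2 mod p"
  have "\<not> inj_on ?sq ?A"
  proof
    assume "inj_on ?sq ?A"
    moreover have "?sq 1 = ?sq (p - 1)"
    proof -
      have "(int p - 1) ^ 2 = 1 + int p * (int p - 2)" by (simp add: power2_eq_square algebra_simps)
      then have "[(int p - 1) ^ 2 = 1] (mod int p)" by (simp add: cong_def)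
      then have "[(p - 1) ^ 2 = 1] (mod p)"
        using p by (simp add: cong_int_iff[symmetric] of_nat_diff)
      then show ?thesis by (simp add: cong_def)
    qed
    ultimately have "1 = p - 1" by (rule inj_onD) (use p in auto)
    then show False using p by simp
  qed
  then have "?sq ` ?A \<noteq> ?A" using eq_card_imp_inj_on[of ?A ?sq] by (metis finite_atLeastLessThan)
  moreover have "?sq ` ?A \<subseteq> ?A"
  proof
    fix y assume "y \<in> ?sq ` ?A"
    then obtain x where x: "1 \<le> x" "x < p" "y = x ^ 2 mod p" by auto
    then have "\<not> p dvd x" by (simp add: nat_dvd_not_less)
    then have "\<not> p dvd x ^ 2" using p prime_dvd_power by blast
    then show "y \<in> ?A"
      using p x by (simp add: dvd_eq_mod_eq_0 Suc_le_eq)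
  qed
  ultimately obtain r where r: "r \<in> ?A" "r \<notin> ?sq ` ?A" by blast
  have "\<not> QuadRes p r"
  proof
    assume "QuadRes p r"
    then obtain y where y: "[y ^ 2 = int r] (mod int p)" by (auto simp: QuadRes_def)
    define z where "z = nat (y mod int p)"
    have z: "int z = y mod int p" using p by (simp add: z_def)
    then have "[int z ^ 2 = int r] (mod int p)" using y by (metis cong_def power_mod)
    then have "[z ^ 2 = r] (mod p)" by (simp add: cong_int_iff[symmetric])
    then have "?sq z = r" using r by (simp add: cong_def)
    moreover have "z < p" using p by (simp add: z_def nat_less_iff)
    moreover have "z \<noteq> 0" using \<open>?sq z = r\<close> r by (cases z) auto
    ultimately have "z \<in> ?A" by simp
    then have "?sq z \<in> ?sq ` ?A" by (rule imageI)
    with \<open>?sq z = r\<close> r(2) show False by simp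
  qed
  moreover have "\<not> [int r = 0] (mod int p)" using r by (auto simp: cong_def)
  ultimately have "Legendre (int r) p = -1" by (simp add: Legendre_def)
  then show ?thesis by (rule that)
qed

text \<open>
  The indices 4 and 8 stand for the characters \<open>n \<mapsto> (-1/n)\<close> and \<open>n \<mapsto> (2/n)\<close> with these moduli; they
  do not clash with the other indices, which will be odd primes.
\<close>

definition quadratic_symbol :: "nat \<Rightarrow> nat \<Rightarrow> real" where
  "quadratic_symbol i n =
    (if i = 4 then (if n mod 4 = 1 then 1 else if n mod 4 = 3 then -1 else 0)
     else if i = 8 then (if n mod 8 \<in> {1, 7} then 1 else if n mod 8 \<in> {3, 5} then -1 else 0)
     else of_int (Legendre (int n) (int i)))"

lemma quadratic_symbol_range: "quadratic_symbol i n \<in> {-1, 0, 1}"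
  using Legendre_range[of "int n" "int i"] by (auto simp: quadratic_symbol_def)

lemma quadratic_symbol_mod:
  assumes "i dvd M"
  shows "quadratic_symbol i (n mod M) = quadratic_symbol i n"
proof -
  have "n mod M mod i = n mod i" using assms by (rule mod_mod_cancel)
  moreover from this have "Legendre (int (n mod M)) (int i) = Legendre (int n) (int i)"
    by (intro Legendre_cong) (metis cong_def cong_int_iff)
  ultimately show ?thesis
    unfolding quadratic_symbol_def by (cases "i = 4"; cases "i = 8") (simp_all only: if_True if_False simp_thms)
qed

lemma quadratic_symbol_4_mult:
  "quadratic_symbol 4 (a * b) = quadratic_symbol 4 a * quadratic_symbol 4 b"
proof -
  have "a mod 4 \<in> {0, 1, 2, 3}" "b mod 4 \<in> {0, 1, 2, 3}" by auto
  then show ?thesis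
    unfolding quadratic_symbol_def mod_mult_eq[of a 4 b, symmetric] by auto
qed

lemma quadratic_symbol_8_mult:
  "quadratic_symbol 8 (a * b) = quadratic_symbol 8 a * quadratic_symbol 8 b"
proof -
  have "a mod 8 \<in> {0, 1, 2, 3, 4, 5, 6, 7}" "b mod 8 \<in> {0, 1, 2, 3, 4, 5, 6, 7}" by auto
  then show ?thesis
    unfolding quadratic_symbol_def mod_mult_eq[of a 8 b, symmetric]
    by (elim insertE emptyE) simp_all
qed

lemma quadratic_symbol_mult:
  assumes "i \<in> {4, 8} \<or> prime i \<and> 2 < i"
  shows "quadratic_symbol i (a * b) = quadratic_symbol i a * quadratic_symbol i b"
  using assms quadratic_symbol_4_mult quadratic_symbol_8_mult
  by (auto simp: quadratic_symbol_def Legendre_mult)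

lemma quadratic_symbol_1:
  assumes "i \<in> {4, 8} \<or> prime i \<and> 2 < i"
  shows "quadratic_symbol i 1 = 1"
  using assms by (auto simp: quadratic_symbol_def Legendre_1)

text \<open>What has to be found is a unit a at which the product is -1. For subsets of {4, 8} the
  residues 7 or 5 modulo 8 serve. Otherwise, for an odd prime q in S, the Chinese remainder theorem
  gives a nonresidue modulo q at which all other symbols are 1.\<close>

lemma prod_quadratic_symbol_character:
  assumes Q: "finite Q" "\<And>q. q \<in> Q \<Longrightarrow> prime q \<and> 2 < q"
    and S: "S \<subseteq> {4, 8} \<union> Q" "S \<noteq> {}"
  shows "\<exists>C. bounded_real_character (\<lambda>n. \<Prod>i\<in>S. quadratic_symbol i n) C"
proof -
  have finS: "finite S" using S Q finite_subset by blast
  have S': "i \<in> {4, 8} \<or> prime i \<and> 2 < i" if "i \<in> S" for i using S Q that by blast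
  obtain M a where M: "M > 0" "\<And>i. i \<in> S \<Longrightarrow> i dvd M" and a: "coprime a M"
    "(\<Prod>i\<in>S. quadratic_symbol i a) = -1"
  proof (cases "S \<subseteq> {4, 8}")
    case True
    have cop: "coprime (7 :: nat) 8" "coprime (5 :: nat) 8"
    proof -
      have "coprime (7 :: nat) (2 ^ 3)" "coprime (5 :: nat) (2 ^ 3)"
        by (subst coprime_power_right_iff, simp)+
      then show "coprime (7 :: nat) 8" "coprime (5 :: nat) 8" by simp_all
    qed
    consider "S = {4}" | "S = {8}" | "S = {4, 8}" using S(2) True by (cases "4 \<in> S"; cases "8 \<in> S") auto
    then show ?thesis
    proof cases
      case 1
      show ?thesis by (rule that[of 8 7]) (auto simp: 1 cop quadratic_symbol_def)
    next
      case 2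
      show ?thesis by (rule that[of 8 5]) (auto simp: 2 cop quadratic_symbol_def)
    next
      case 3
      show ?thesis by (rule that[of 8 7]) (auto simp: 3 cop quadratic_symbol_def)
    qed
  next
    case False
    then obtain q where q: "q \<in> S" "q \<in> Q" using S by blast
    then have qp: "prime q" "2 < q" using Q by auto
    obtain r where r: "Legendre (int r) q = -1" using nonresidue_exists[OF qp] .
    \<comment> \<open>Including 8 makes a = 1 modulo 4 and 8 as well, so these two symbols are 1 at
      a.\<close>
    define M' where "M' = 8 * \<Prod>(Q - {q})"
    have "coprime q (\<Prod>(Q - {q}))"
      using Q qp by (intro prod_coprime_right) (auto simp: primes_coprime)
    moreover have "coprime q 8"
    proof -
      have "odd q" using qp prime_odd_nat by blast
      then have "coprime q (2 ^ 3)" by (subst coprime_power_right_iff) simp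
      then show ?thesis by simp
    qed
    ultimately have cop: "coprime q M'" by (simp add: M'_def)
    obtain a where a: "[a = r] (mod q)" "[a = 1] (mod M')"
      using binary_chinese_remainder_nat[OF cop] by blast
    show ?thesis
    proof (rule that[of "q * M'" a])
      show "q * M' > 0" using Q qp by (auto simp: M'_def intro!: prod_pos Nat.gr0I)
      show "i dvd q * M'" if "i \<in> S" for i
      proof -
        consider "i = q" | "i \<in> {4, 8}" | "i \<in> Q - {q}" using \<open>i \<in> S\<close> S by blast
        then show ?thesis
        proof cases
          case 2
          then have "i dvd 8" by auto
          then show ?thesis by (simp add: M'_def)
        next
          case 3
          then have "i dvd \<Prod>(Q - {q})" using Q by (intro dvd_prodI) auto
          then show ?thesis by (simp add: M'_def)
        qed simp
      qed
      have "coprime a M'" using a(2) by (metis cong_imp_coprime cong_sym coprime_1_left)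
      moreover have "Legendre (int a) q = -1"
        using r a(1) Legendre_cong[of "int a" "int r" "int q"] by (simp add: cong_int_iff)
      then have "\<not> [int a = 0] (mod int q)" by (auto simp: Legendre_def split: if_splits)
      then have "\<not> q dvd a" by (simp add: cong_0_iff)
      then have "coprime a q" using prime_imp_coprime[of q a] qp by (simp add: coprime_commute)
      ultimately show "coprime a (q * M')" by simp
      have "quadratic_symbol i a = 1" if "i \<in> S - {q}" for i
      proof -
        have "i dvd M'"
        proof (cases "i \<in> {4, 8}")
          case True
          then have "i dvd 8" by auto
          then show ?thesis by (simp add: M'_def)
        next
          case False
          then have "i dvd \<Prod>(Q - {q})" using Q that S by (intro dvd_prodI) auto
          then show ?thesis by (simp add: M'_def)
        qed
        then have "quadratic_symbol i a = quadratic_symbol i 1"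
          using a(2) quadratic_symbol_mod by (metis cong_def)
        then show ?thesis using quadratic_symbol_1[OF S'] that by simp
      qed
      moreover have "quadratic_symbol q a = -1"
        using qp \<open>Legendre (int a) q = -1\<close> by (auto simp: quadratic_symbol_def)
      ultimately show "(\<Prod>i\<in>S. quadratic_symbol i a) = -1"
        using q finS by (simp add: prod.remove[of S q])
    qed
  qed
  have "bounded_real_character (\<lambda>n. \<Prod>i\<in>S. quadratic_symbol i n) (real M)"
  proof (rule bounded_real_characterI)
    show "(\<Prod>i\<in>S. quadratic_symbol i (x * y)) =
        (\<Prod>i\<in>S. quadratic_symbol i x) * (\<Prod>i\<in>S. quadratic_symbol i y)" for x y
      unfolding prod.distrib[symmetric] by (intro prod.cong refl quadratic_symbol_mult S')
    show "(\<Prod>i\<in>S. quadratic_symbol i 1) = 1"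
      using quadratic_symbol_1 S' by (intro prod.neutral) auto
    show "(\<Prod>i\<in>S. quadratic_symbol i n) \<in> {-1, 0, 1}" for n
      using finS
    proof (induction S rule: finite_induct)
      case (insert i S)
      then show ?case using quadratic_symbol_range[of i n] by auto
    qed simp
    show "(\<Prod>i\<in>S. quadratic_symbol i (n mod M)) = (\<Prod>i\<in>S. quadratic_symbol i n)" for n
      using M by (intro prod.cong refl quadratic_symbol_mod)
  qed (use M a in auto)
  then show ?thesis by blast
qed

theorem prime_with_Legendre_values:
  fixes \<eta> :: "nat \<Rightarrow> int" and \<delta> :: int
  assumes Q: "finite Q" "\<And>q. q \<in> Q \<Longrightarrow> prime q \<and> 2 < q"
    and signs: "\<And>q. q \<in> Q \<Longrightarrow> \<eta> q \<in> {-1, 1}" "\<delta> \<in> {-1, 1}"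
  obtains p :: nat where "prime p" "p mod 4 = 1" "Legendre 2 p = \<delta>"
    "\<And>q. q \<in> Q \<Longrightarrow> Legendre p q = \<eta> q"
proof -
  define \<epsilon> :: "nat \<Rightarrow> real" where "\<epsilon> = (\<lambda>i. if i = 4 then 1 else if i = 8 then of_int \<delta> else of_int (\<eta> i))"
  have not_prime: "\<not> prime (4 :: nat)" "\<not> prime (8 :: nat)"
    using prime_product[of 2 "2 :: nat"] prime_product[of 2 "4 :: nat"] by auto
  then have "4 \<notin> Q" "8 \<notin> Q" using Q by blast+
  \<comment> \<open>Excluding 2 and the members of Q keeps all symbols at p nonzero, so that
    differing from -\<epsilon> means equality with \<epsilon>.\<close>
  obtain p where p: "prime p" "p \<notin> {2} \<union> Q"
    "\<And>i. i \<in> {4, 8} \<union> Q \<Longrightarrow> quadratic_symbol i p \<noteq> - \<epsilon> i"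
  proof (rule prime_with_real_character_values[of "{4, 8} \<union> Q" "{2} \<union> Q" quadratic_symbol \<epsilon>])
    show "\<exists>C. bounded_real_character (\<lambda>n. \<Prod>i\<in>S. quadratic_symbol i n) C"
      if "S \<subseteq> {4, 8} \<union> Q" "S \<noteq> {}" for S
      using prod_quadratic_symbol_character[OF Q that] by blast
    show "\<epsilon> i \<in> {-1, 1}" if "i \<in> {4, 8} \<union> Q" for i
      using that signs \<open>4 \<notin> Q\<close> \<open>8 \<notin> Q\<close> by (fastforce simp: \<epsilon>_def)
  qed (use Q in auto)
  have p2: "2 < p" using p(1,2) prime_ge_2_nat[OF p(1)] by auto
  then have "odd p" using p(1) prime_odd_nat by blast
  show ?thesis
  proof (rule that[OF p(1)])
    have "p mod 4 \<noteq> 3" using p(3)[of 4] by (auto simp: quadratic_symbol_def \<epsilon>_def)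
    then show "p mod 4 = 1" using \<open>odd p\<close> by presburger
    have "p mod 8 \<in> {1, 3, 5, 7}" using \<open>odd p\<close> by simp presburger
    then show "Legendre 2 p = \<delta>"
      using p(3)[of 8] signs(2) by (auto simp: quadratic_symbol_def \<epsilon>_def Legendre_2[OF p(1) p2])
    fix q assume q: "q \<in> Q"
    then have "q \<noteq> 4" "q \<noteq> 8" using q \<open>4 \<notin> Q\<close> \<open>8 \<notin> Q\<close> by auto
    then have "Legendre p q \<noteq> - \<eta> q" using p(3)[of q] q by (auto simp: quadratic_symbol_def \<epsilon>_def)
    moreover have "\<not> q dvd p" using q p(1,2) Q(2)[OF q] by (metis UnCI primes_dvd_imp_eq)
    then have "Legendre p q \<noteq> 0" by (simp add: Legendre_def cong_0_iff)
    ultimately show "Legendre p q = \<eta> q"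
      using Legendre_range[of p q] signs(1)[OF q] by auto
  qed
qed

section \<open>Legendre's theorem and sums of three rational squares\<close>

lemma ceiling_sqrt:
  fixes N :: nat
  assumes "N > 0"
  obtains Z :: nat where "Z > 0" "N \<le> Z ^ 2" "\<And>z :: nat. z < Z \<Longrightarrow> z ^ 2 < N"
proof -
  define Z where "Z = (LEAST z. N \<le> z ^ 2)"
  have "N \<le> N ^ 2" using assms by (simp add: power2_eq_square)
  then have 1: "N \<le> Z ^ 2" unfolding Z_def by (rule LeastI)
  have 2: "z ^ 2 < N" if "z < Z" for z
    using not_less_Least[of z "\<lambda>z. N \<le> z ^ 2"] that unfolding Z_def by simp
  have "Z > 0" using 1 assms by (cases Z) auto
  with 1 2 show ?thesis using that by blast
qed

text \<open>A pigeonhole argument: a box with more than m t points contains two whose difference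
  satisfies z = r v modulo m and z = s w modulo t. Then z^2 + t v^2 - m w^2 is a multiple of m t,
  and the side lengths leave only the values 0 and m t.\<close>

theorem legendre_conic:
  fixes m t :: nat and r s :: int
  assumes pos: "m > 0" "t > 0" and cop: "coprime m t" and nonsquare: "\<And>k. m * t \<noteq> k ^ 2"
    and r: "[r ^ 2 = - int t] (mod int m)" and s: "[s ^ 2 = int m] (mod int t)"
  obtains z v w :: int where "z ^ 2 + int t * v ^ 2 = int m * w ^ 2" "w \<noteq> 0"
proof -
  obtain Z where Z: "Z > 0" "m * t \<le> Z ^ 2" "\<And>z :: nat. z < Z \<Longrightarrow> z ^ 2 < m * t"
    using ceiling_sqrt[of "m * t"] pos by auto
  obtain V where V: "V > 0" "m \<le> V ^ 2" "\<And>z :: nat. z < V \<Longrightarrow> z ^ 2 < m"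
    using ceiling_sqrt[of m] pos by auto
  obtain W where W: "W > 0" "t \<le> W ^ 2" "\<And>z :: nat. z < W \<Longrightarrow> z ^ 2 < t"
    using ceiling_sqrt[of t] pos by auto
  have "(m * t) ^ 2 < (Z * V * W) ^ 2"
  proof -
    \<comment> \<open>As m t is not a square, this inequality is strict, which makes the box larger
      than the number of residue pairs.\<close>
    have "m * t < Z ^ 2" using Z nonsquare[of Z] by simp
    moreover have "m * t \<le> V ^ 2 * W ^ 2" using V W by (intro mult_mono) auto
    ultimately have "(m * t) * (m * t) < Z ^ 2 * (V ^ 2 * W ^ 2)"
      using pos by (intro mult_less_le_imp_less) auto
    then show ?thesis by (simp add: power_mult_distrib power2_eq_square mult_ac)
  qed
  then have "m * t < Z * V * W" by (rule power_less_imp_less_base) simp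
  define box where "box = {..<Z} \<times> {..<V} \<times> {..<W}"
  define res where "res = (\<lambda>(z, v, w). ((int z - r * int v) mod int m, (int z - s * int w) mod int t))"
  have "res ` box \<subseteq> {0..<int m} \<times> {0..<int t}"
    using pos by (auto simp: res_def)
  then have "card (res ` box) \<le> card ({0..<int m} \<times> {0..<int t})"
    by (rule card_mono[rotated]) simp
  also have "\<dots> = m * t" by simp
  also have "\<dots> < card box" using \<open>m * t < Z * V * W\<close> by (simp add: box_def)
  finally have "\<not> inj_on res box" using card_image by fastforce
  then obtain a b where ab: "a \<in> box" "b \<in> box" "res a = res b" "a \<noteq> b"
    unfolding inj_on_def by blast
  obtain z1 v1 w1 z2 v2 w2 where a: "a = (z1, v1, w1)" and b: "b = (z2, v2, w2)"
    by (metis prod_cases3)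
  define z where "z = int z1 - int z2"
  define v where "v = int v1 - int v2"
  define w where "w = int w1 - int w2"
  have diff: "(int x - int y) ^ 2 < int N"
    if "x < R" "y < R" "\<And>z :: nat. z < R \<Longrightarrow> z ^ 2 < N" for x y R N
  proof -
    have "(int x - int y) ^ 2 = int ((nat \<bar>int x - int y\<bar>) ^ 2)" by simp
    moreover have "nat \<bar>int x - int y\<bar> < R" using that by linarith
    ultimately show ?thesis using that(3) by (metis of_nat_less_iff)
  qed
  have zb: "z ^ 2 < int (m * t)" and vb: "v ^ 2 < int m" and wb: "w ^ 2 < int t"
    unfolding z_def v_def w_def using ab(1,2) a b Z V W
    by (auto simp: box_def intro!: diff simp del: of_nat_mult)
  have "int m dvd z - r * v" "int t dvd z - s * w"
    using ab(3) unfolding a b res_def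
    by (auto simp: mod_eq_dvd_iff z_def v_def w_def algebra_simps)
  then obtain j k where jk: "z = r * v + int m * j" "z = s * w + int t * k"
    by (metis add.commute diff_add_cancel dvdE)
  define N where "N = z ^ 2 + int t * v ^ 2 - int m * w ^ 2"
  have "[N = 0] (mod int m)"
  proof -
    have "[z = r * v] (mod int m)" unfolding jk(1) by (simp add: cong_def)
    then have "[z ^ 2 = (r * v) ^ 2] (mod int m)" by (rule cong_pow)
    also have "[(r * v) ^ 2 = - int t * v ^ 2] (mod int m)"
      unfolding power_mult_distrib using r by (rule cong_scalar_right)
    finally have "int m dvd z ^ 2 + int t * v ^ 2" by (simp add: cong_iff_dvd_diff)
    then show ?thesis by (simp add: N_def cong_0_iff)
  qed
  moreover have "[N = 0] (mod int t)"
  proof -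
    have "[z = s * w] (mod int t)" unfolding jk(2) by (simp add: cong_def)
    then have "[z ^ 2 = (s * w) ^ 2] (mod int t)" by (rule cong_pow)
    also have "[(s * w) ^ 2 = int m * w ^ 2] (mod int t)"
      unfolding power_mult_distrib using s by (rule cong_scalar_right)
    finally have "int t dvd (z ^ 2 - int m * w ^ 2) + int t * v ^ 2"
      by (simp add: cong_iff_dvd_diff)
    then show ?thesis by (simp add: N_def cong_0_iff algebra_simps)
  qed
  ultimately have "int m * int t dvd N"
    using cop by (simp add: cong_0_iff divides_mult)
  then obtain l where l: "N = int m * int t * l" by (elim dvdE)
  have mt: "0 < int m * int t" using pos by simp
  have "int t * v ^ 2 < int m * int t" "int m * w ^ 2 < int m * int t"
    using vb wb pos by simp_all
  moreover have "0 \<le> int t * v ^ 2" "0 \<le> int m * w ^ 2" by simp_all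
  moreover have "z ^ 2 < int m * int t" using zb by simp
  ultimately have "N < int m * int t * 2" "int m * int t * (-1) < N"
    using zero_le_power2[of z] unfolding N_def by linarith+
  then have "l < 2" "-1 < l"     unfolding l mult_less_cancel_left_pos[OF mt] .
  then consider "l = 0" | "l = 1" by linarith
  then show ?thesis
  proof cases
    case 1
    then have eq: "z ^ 2 + int t * v ^ 2 = int m * w ^ 2" using l by (simp add: N_def)
    have "w \<noteq> 0"
    proof
      assume "w = 0"
      then have "z ^ 2 + int t * v ^ 2 = 0" using eq by simp
      moreover have "0 \<le> int t * v ^ 2" by simp
      ultimately have "z ^ 2 = 0" "int t * v ^ 2 = 0"
        using zero_le_power2[of z] by linarith+
      then have "z = 0" "v = 0" using pos by auto
      then show False using \<open>w = 0\<close> ab(4) by (simp add: z_def v_def w_def a b)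
    qed
    with eq show ?thesis by (rule that)
  next
    case 2
    then have eq: "z ^ 2 + int t * v ^ 2 = int m * (w ^ 2 + int t)"
      using l by (simp add: N_def algebra_simps)
    \<comment> \<open>Norms in the ring generated by the square root of -t: multiply z + v sqrt(-t)
      by w - sqrt(-t). In the case N = m t this turns the equation into a solution with last entry
      w^2 + t.\<close>
    have "(z * w + int t * v) ^ 2 + int t * (z - v * w) ^ 2 =
        (z ^ 2 + int t * v ^ 2) * (w ^ 2 + int t)"
      by (simp add: power2_eq_square algebra_simps)
    also have "\<dots> = int m * (w ^ 2 + int t) ^ 2"
      unfolding eq by (simp add: power2_eq_square)
    finally show ?thesis
    proof (rule that)
      have "0 < w ^ 2 + int t" using pos by (simp add: add_nonneg_pos)
      then show "w ^ 2 + int t \<noteq> 0" by simp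
    qed
  qed
qed

section \<open>Residue conditions and sums of three rational squares\<close>

lemma square_mod_prod_primes:
  fixes a :: int
  assumes "finite A" "\<And>q. q \<in> A \<Longrightarrow> prime (q :: nat) \<and> (\<exists>y. [y ^ 2 = a] (mod int q))"
  shows "\<exists>y. [y ^ 2 = a] (mod int (\<Prod>A))"
  using assms
proof (induction A rule: finite_induct)
  case (insert q A)
  from insert.IH insert.prems obtain y where y: "[y ^ 2 = a] (mod int (\<Prod>A))" by blast
  from insert.prems obtain z where z: "[z ^ 2 = a] (mod int q)" by blast
  have "coprime q (\<Prod>A)"
    using insert by (intro prod_coprime_right) (metis insertI1 insertI2 primes_coprime)
  then have "coprime (int q) (int (\<Prod>A))" by (simp only: coprime_int_iff)
  then obtain x where x: "[x = z] (mod int q)" "[x = y] (mod int (\<Prod>A))"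
    using binary_chinese_remainder_int by blast
  have "[x ^ 2 = a] (mod int q)" using cong_trans[OF cong_pow[OF x(1)] z] .
  moreover have "[x ^ 2 = a] (mod int (\<Prod>A))" using cong_trans[OF cong_pow[OF x(2)] y] .
  ultimately have "[x ^ 2 = a] (mod int q * int (\<Prod>A))"
    using \<open>coprime (int q) (int (\<Prod>A))\<close> by (simp add: coprime_cong_mult)
  then show ?case using insert.hyps by (auto simp del: of_nat_prod)
qed (auto simp: cong_def)

lemma square_mod_2: "[(a :: int) ^ 2 = a] (mod 2)"
  by (auto simp: cong_iff_dvd_diff)

lemma Legendre_eq_1_square:
  assumes "Legendre a p = 1"
  shows "\<exists>y. [y ^ 2 = a] (mod p)"
  using assms by (auto simp: Legendre_def QuadRes_def split: if_splits)

text \<open>The left side is the Jacobi symbol of -1 over the product of Q. Oddness is carried along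
  so that in the induction step both factors are 1 or 3 modulo 4.\<close>

lemma prod_Legendre_minus_1:
  assumes "finite Q" "\<And>q. q \<in> Q \<Longrightarrow> prime (q :: nat) \<and> 2 < q"
  shows "(\<Prod>q\<in>Q. Legendre (-1) (int q)) = (if \<Prod>Q mod 4 = 1 then 1 else -1) \<and> odd (\<Prod>Q)"
  using assms
proof (induction Q rule: finite_induct)
  case (insert q Q)
  have q: "prime q" "2 < q" using insert by auto
  have "odd q" using q prime_odd_nat by blast
  moreover have "odd (\<Prod>Q)" using insert by auto
  ultimately have "q mod 4 \<in> {1, 3}" "\<Prod>Q mod 4 \<in> {1, 3}" by simp_all presburger+
  then have "q * \<Prod>Q mod 4 = 1 \<longleftrightarrow> (q mod 4 = 1 \<longleftrightarrow> \<Prod>Q mod 4 = 1)"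
    unfolding mod_mult_eq[of q 4 "\<Prod>Q", symmetric] by auto
  then show ?case
    using insert \<open>odd q\<close> \<open>odd (\<Prod>Q)\<close> Legendre_minus_1[OF q] by auto
qed auto

lemma prod_Legendre_minus_2:
  assumes "finite Q" "\<And>q. q \<in> Q \<Longrightarrow> prime (q :: nat) \<and> 2 < q"
  shows "(\<Prod>q\<in>Q. Legendre (-2) (int q)) = (if \<Prod>Q mod 8 \<in> {1, 3} then 1 else -1) \<and> odd (\<Prod>Q)"
  using assms
proof (induction Q rule: finite_induct)
  case (insert q Q)
  have q: "prime q" "2 < q" using insert by auto
  have "odd q" using q prime_odd_nat by blast
  moreover have "odd (\<Prod>Q)" using insert by auto
  ultimately have m: "q mod 8 \<in> {1, 3, 5, 7}" "\<Prod>Q mod 8 \<in> {1, 3, 5, 7}" by simp_all presburger+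
  then have p: "q * \<Prod>Q mod 8 \<in> {1, 3} \<longleftrightarrow> (q mod 8 \<in> {1, 3} \<longleftrightarrow> \<Prod>Q mod 8 \<in> {1, 3})"
    unfolding mod_mult_eq[of q 8 "\<Prod>Q", symmetric] by (elim insertE emptyE) simp_all
  have "q mod 4 = q mod 8 mod 4" by (simp add: mod_mod_cancel)
  then have "Legendre (-2) (int q) = (if q mod 8 \<in> {1, 3} then 1 else -1)"
    using Legendre_mult[OF q, of "-1" 2] m(1) by (auto simp: Legendre_minus_1[OF q] Legendre_2[OF q])
  then show ?case using insert \<open>odd q\<close> \<open>odd (\<Prod>Q)\<close> p by auto
qed auto

text \<open>The case t = 1 of the conic, since -1 is a square modulo p; a rational representation
  suffices below.\<close>

lemma prime_sum_two_rational_squares: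
  fixes p :: nat
  assumes "prime p" "p mod 4 = 1"
  obtains a b c :: int where "int p * c ^ 2 = a ^ 2 + b ^ 2" "c \<noteq> 0"
proof -
  have "p \<noteq> 2" using assms(2) by auto
  then have "2 < p" using prime_ge_2_nat[OF assms(1)] by simp
  then have "Legendre (-1) (int p) = 1" using Legendre_minus_1 assms by simp
  then obtain r where r: "[r ^ 2 = -1] (mod int p)" using Legendre_eq_1_square by blast
  have nonsquare: "p * 1 \<noteq> k ^ 2" for k
    using assms(1) prime_power_iff[of k 2] by auto
  obtain z v w where "z ^ 2 + int 1 * v ^ 2 = int p * w ^ 2" "w \<noteq> 0"
  proof (rule legendre_conic)
    show "[r ^ 2 = - int 1] (mod int p)" using r by simp
    show "[0 ^ 2 = int p] (mod int 1)" by (simp add: cong_def)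
  qed (use \<open>2 < p\<close> nonsquare in auto)
  then show ?thesis using that[of w z v] by simp
qed

text \<open>The conic for t needs -t to be a square modulo m and m to be a square modulo t.
  Prescribing (p/q) = (-c/q) for odd q dividing m settles the first condition; reciprocity, the
  choice of (2/p) and m mod 8 \<noteq> 7 settle the second.\<close>

theorem three_rational_squares:
  fixes m :: nat
  assumes "m > 0" "squarefree m" "m mod 8 \<noteq> 7"
  obtains w x y z :: int where "int m * w ^ 2 = x ^ 2 + y ^ 2 + z ^ 2" "w \<noteq> 0"
proof -
  define P where "P = prime_factors m"
  define Q where "Q = P - {2}"
  have finP: "finite P" "finite Q" by (auto simp: P_def Q_def)
  have P: "prime q" "q dvd m" if "q \<in> P" for q using that by (auto simp: P_def)
  have Q: "prime q \<and> 2 < q" if "q \<in> Q" for q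
    using that P[of q] prime_ge_2_nat[of q] by (auto simp: Q_def)
  have m: "m = \<Prod>P"
    using assms prod_prime_factors[of m] squarefree_factorial_semiring'[of m] by (simp add: P_def)
  \<comment> \<open>\<open>t = c p\<close>; the choice of \<open>c\<close> makes \<open>(-c/m) = 1\<close> for odd \<open>m\<close>.\<close>
  define c :: nat where "c = (if m mod 8 = 3 then 2 else 1)"
  define \<eta> where "\<eta> = (\<lambda>q :: nat. Legendre (- int c) q)"
  \<comment> \<open>For even m the value (2/p) is prescribed as \<delta>, which makes (m/p) =
    \<delta> \<delta> = 1. For odd m the product \<delta> itself has to be 1.\<close>
  define \<delta> where "\<delta> = (\<Prod>q\<in>Q. \<eta> q)"
  have odd_Q: "odd (\<Prod>Q)" using prod_Legendre_minus_1 finP Q by blast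
  have \<eta>: "\<eta> q \<in> {-1, 1}" if "q \<in> Q" for q
  proof -
    have "\<not> q dvd c" using Q[OF that] by (auto simp: c_def nat_dvd_not_less)
    then show ?thesis using Legendre_range[of "- int c" q] by (auto simp: \<eta>_def Legendre_def cong_0_iff)
  qed
  have \<delta>: "\<delta> = 1" if "2 \<notin> P"
  proof -
    have "Q = P" using that by (simp add: Q_def)
    then have "\<Prod>Q = m" using m by simp
    then have "m mod 8 = 3 \<or> m mod 4 = 1" using odd_Q assms(3) by presburger
    then show ?thesis
      using prod_Legendre_minus_1[OF finP(2) Q] prod_Legendre_minus_2[OF finP(2) Q] \<open>\<Prod>Q = m\<close>
      by (auto simp: \<delta>_def \<eta>_def c_def)
  qed
  have sign: "\<delta> \<in> {-1, 1}"
    unfolding \<delta>_def using finP(2) \<eta>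
  proof (induction Q rule: finite_induct)
    case (insert q Q)
    then have "\<eta> q \<in> {-1, 1}" "prod \<eta> Q \<in> {-1, 1}" by auto
    then show ?case using insert.hyps by auto
  qed simp
  obtain p :: nat where p: "prime p" "p mod 4 = 1" "Legendre 2 p = \<delta>"
    "\<forall>q\<in>Q. Legendre p q = \<eta> q"
  proof (rule prime_with_Legendre_values[OF finP(2) Q \<eta> sign])
    fix p :: nat
    assume "prime p" "p mod 4 = 1" "Legendre 2 p = \<delta>"
      "\<And>q. q \<in> Q \<Longrightarrow> Legendre p q = \<eta> q"
    then show thesis by (intro that ballI) simp_all
  qed
  have "p \<noteq> 2" using p(2) by auto
  then have p2: "2 < p" using prime_ge_2_nat[OF p(1)] by simp
  have "p \<notin> P"
  proof
    assume "p \<in> P"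
    then have "p \<in> Q" using \<open>p \<noteq> 2\<close> by (simp add: Q_def)
    then have "Legendre p p \<in> {-1, 1}" using p(4) \<eta>[of p] by simp
    then show False by (simp add: Legendre_def cong_def)
  qed
  then have "\<not> p dvd m" using p(1) assms(1) by (auto simp: P_def prime_factors_dvd)
  \<comment> \<open>As p is 1 modulo 4, reciprocity carries no sign.\<close>
  have "Legendre q p = \<eta> q" if "q \<in> Q" for q
  proof -
    have "q \<noteq> p" using that \<open>p \<notin> P\<close> by (auto simp: Q_def)
    moreover have "even ((p - 1) div 2)" using p(2) by presburger
    ultimately have "Legendre p q * Legendre q p = 1"
      using Quadratic_Reciprocity[of p q] p(1) p2 Q[OF that] by simp
    then show ?thesis using p(4) that \<eta>[OF that] by auto
  qed
  then have "(\<Prod>q\<in>Q. Legendre q p) = \<delta>" by (simp add: \<delta>_def)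
  then have "(\<Prod>q\<in>P. Legendre q p) = 1"
    using \<delta> p(3) finP sign prod.remove[of P 2 "\<lambda>q. Legendre (int q) p"]
    by (cases "2 \<in> P") (auto simp: Q_def)
  then have "Legendre m p = 1"
    unfolding m of_nat_prod using Legendre_prod[OF p(1) p2 finP(1), of int] by simp
  then have mp: "\<exists>s. [s ^ 2 = int m] (mod int p)" by (rule Legendre_eq_1_square)
  define t where "t = c * p"
  obtain s where s: "[s ^ 2 = int m] (mod int t)"
  proof (cases "c = 1")
    case True
    then show ?thesis using mp that by (auto simp: t_def)
  next
    case False
    \<comment> \<open>Here t = 2 p; modulo 2 every integer is a square, so only the condition at p
      matters.\<close>
    then have "t = \<Prod>{2, p}" using \<open>p \<noteq> 2\<close> by (auto simp: t_def c_def split: if_splits)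
    moreover have "\<exists>y. [y ^ 2 = int m] (mod int (\<Prod>{2, p}))"
      using mp square_mod_2[of "int m"] p(1) by (intro square_mod_prod_primes) auto
    ultimately show ?thesis using that by auto
  qed
  obtain r where r: "[r ^ 2 = - int t] (mod int m)"
  proof -
    have "\<exists>y. [y ^ 2 = - int t] (mod int q)" if "q \<in> P" for q
    proof (cases "q = 2")
      case True
      then show ?thesis using square_mod_2[of "- int t"] by auto
    next
      case False
      then have q: "q \<in> Q" using that by (simp add: Q_def)
      have "Legendre (- int t) q = \<eta> q * \<eta> q"
        using Legendre_mult[of q "- int c" p] Q[OF q] p(4) q by (simp add: t_def \<eta>_def)
      then have "Legendre (- int t) q = 1" using \<eta>[OF q] by auto
      then show ?thesis by (rule Legendre_eq_1_square)
    qed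
    then show ?thesis
      using square_mod_prod_primes[of P "- int t"] finP P that m by auto
  qed
  have "coprime m c"
  proof (cases "c = 1")
    case False
    then have "c = 2" "m mod 8 = 3" by (simp_all add: c_def split: if_splits)
    then have "odd m" by presburger
    then show ?thesis using \<open>c = 2\<close> by simp
  qed simp
  then have "coprime m t"
    using p(1) \<open>\<not> p dvd m\<close> prime_imp_coprime[of p m] by (simp add: t_def coprime_commute)
  moreover have "m * t \<noteq> k ^ 2" for k
  proof
    assume eq: "m * t = k ^ 2"
    then have "p dvd k ^ 2" by (metis dvd_triv_right dvd_mult t_def)
    then have "p dvd k" using p(1) prime_dvd_power by blast
    then obtain j where "k = p * j" by (elim dvdE)
    then have "m * c = p * j ^ 2" using eq p2 by (simp add: t_def power2_eq_square)
    then have "p dvd m * c" by simp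
    then have "p dvd c" using p(1) \<open>\<not> p dvd m\<close> by (simp add: prime_dvd_mult_iff)
    then show False using p2 by (auto simp: c_def nat_dvd_not_less split: if_splits)
  qed
  moreover have "t > 0" using p2 by (simp add: t_def c_def)
  ultimately obtain z v w where zvw: "z ^ 2 + int t * v ^ 2 = int m * w ^ 2" "w \<noteq> 0"
    using legendre_conic[of m t r s] assms(1) r s by blast
  obtain a0 b0 d where abd0: "int p * d ^ 2 = a0 ^ 2 + b0 ^ 2" "d \<noteq> 0"
    using prime_sum_two_rational_squares[OF p(1,2)] .
  obtain a b where abd: "int t * d ^ 2 = a ^ 2 + b ^ 2"
  proof (cases "c = 1")
    case True
    then show ?thesis using that[of a0 b0] abd0 by (simp add: t_def)
  next
    case False
    then have "c = 2" by (simp add: c_def split: if_splits)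
    \<comment> \<open>The factor 2 is absorbed by 2 (a^2 + b^2) = (a + b)^2 + (a - b)^2.\<close>
    then show ?thesis
      using that[of "a0 + b0" "a0 - b0"] abd0 by (simp add: t_def power2_eq_square algebra_simps)
  qed
  have "int m * (d * w) ^ 2 = d ^ 2 * (int m * w ^ 2)" by (simp add: power_mult_distrib)
  also have "\<dots> = (d * z) ^ 2 + (int t * d ^ 2) * v ^ 2"
    unfolding zvw(1)[symmetric] by (simp add: power_mult_distrib algebra_simps)
  also have "\<dots> = (d * z) ^ 2 + (a * v) ^ 2 + (b * v) ^ 2"
    unfolding abd by (simp add: power_mult_distrib algebra_simps)
  finally show ?thesis using that[of "d * w"] abd0(2) zvw(2) by simp
qed

section \<open>Forms as coefficient sequences\<close>

locale complex_subfield =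
  fixes K :: "complex set"
  assumes subfield: "subfield K complex_field"
begin

lemma zero_mem: "0 \<in> K" and one_mem: "1 \<in> K"
  and add_mem: "a \<in> K \<Longrightarrow> b \<in> K \<Longrightarrow> a + b \<in> K"
  and mult_mem: "a \<in> K \<Longrightarrow> b \<in> K \<Longrightarrow> a * b \<in> K"
  using subringE(2,3,6,7)[OF subfieldE(1)[OF subfield]]
  by (simp_all add: ring_of_type_algebra_def)

text \<open>Negation in the record \<open>complex_field\<close> is derived from its addition, so it
  is matched with the usual negation through the equation defining an additive inverse.\<close>

lemma uminus_mem: "a \<in> K \<Longrightarrow> - a \<in> K"
proof -
  assume a: "a \<in> K"
  interpret R: ring complex_field by (rule ring_from_type_algebra)
  have "\<ominus>\<^bsub>complex_field\<^esub> a \<in> K" using subringE(5)[OF subfieldE(1)[OF subfield] a] .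
  moreover have "\<ominus>\<^bsub>complex_field\<^esub> a + a = 0"
    using R.l_neg[of a] by (simp add: ring_of_type_algebra_def)
  then have "\<ominus>\<^bsub>complex_field\<^esub> a = - a" by (simp add: eq_neg_iff_add_eq_0)
  ultimately show ?thesis by simp
qed

lemma inverse_mem: "a \<in> K \<Longrightarrow> inverse a \<in> K"
proof (cases "a = 0")
  case False
  assume a: "a \<in> K"
  interpret R: field complex_field by (rule field_from_type_algebra)
  have "a \<in> K - {\<zero>\<^bsub>complex_field\<^esub>}" using a False by (simp add: ring_of_type_algebra_def)
  then have "inv\<^bsub>complex_field\<^esub> a \<in> K" "a * (inv\<^bsub>complex_field\<^esub> a) = 1"
    using R.subfield_m_inv[OF subfield, of a] by (simp_all add: ring_of_type_algebra_def)
  then show ?thesis by (metis inverse_unique)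
qed simp

lemma diff_mem: "a \<in> K \<Longrightarrow> b \<in> K \<Longrightarrow> a - b \<in> K"
  using add_mem[OF _ uminus_mem] by simp

lemma divide_mem: "a \<in> K \<Longrightarrow> b \<in> K \<Longrightarrow> a / b \<in> K"
  unfolding divide_inverse by (intro mult_mem inverse_mem)

lemma of_nat_mem: "of_nat n \<in> K"
  by (induction n) (simp_all add: zero_mem one_mem add_mem)

lemma numeral_mem: "numeral n \<in> K"
  using of_nat_mem[of "numeral n"] by simp

lemma of_int_mem: "of_int n \<in> K"
  by (cases n rule: int_cases2) (simp_all add: of_nat_mem uminus_mem)

lemma power_mem: "a \<in> K \<Longrightarrow> a ^ n \<in> K"
  by (induction n) (simp_all add: one_mem mult_mem)

lemmas mem = zero_mem one_mem add_mem mult_mem uminus_mem diff_mem divide_mem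
  of_nat_mem numeral_mem of_int_mem power_mem

end

section \<open>Power sums of linear forms and apolarity for the sextic\<close>

text \<open>Splitting off the binomial coefficients turns the coefficients of a power of a linear
  form into monomials in its two entries, so a representation becomes a moment problem.\<close>

definition form_of_coeffs :: "nat \<Rightarrow> (nat \<Rightarrow> complex) \<Rightarrow> bipoly" where
  "form_of_coeffs d a = (\<Sum>k\<le>d. monom (monom (of_nat (d choose k) * a k) (d - k)) k)"

lemma form_of_coeffs_eq_iff:
  "form_of_coeffs d a = form_of_coeffs d b \<longleftrightarrow> (\<forall>k\<le>d. a k = b k)"
proof
  have c: "coeff (coeff (form_of_coeffs d a) k) (d - k) = of_nat (d choose k) * a k" if "k \<le> d" for a k
    using that by (simp add: form_of_coeffs_def coeff_sum sum.delta if_distrib[of "\<lambda>p. coeff p _"] cong: if_cong)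
  show "form_of_coeffs d a = form_of_coeffs d b \<Longrightarrow> \<forall>k\<le>d. a k = b k"
  proof (intro allI impI)
    fix k assume eq: "form_of_coeffs d a = form_of_coeffs d b" and k: "k \<le> d"
    have "of_nat (d choose k) * a k = of_nat (d choose k) * b k"
      unfolding c[OF k, symmetric] eq ..
    moreover have "d choose k \<noteq> 0" using k by simp
    ultimately show "a k = b k" by simp
  qed
qed (simp add: form_of_coeffs_def)

lemma cst_mult_powers: "cst c * var_x ^ i * var_y ^ k = monom (monom c i) k"
proof -
  have "var_x ^ i = [:monom 1 i:]"
    by (simp add: var_x_def monom_altdef poly_const_pow)
  moreover have "var_y ^ k = monom 1 k"
    by (simp add: var_y_def monom_altdef)
  ultimately show ?thesis
    by (simp add: cst_def smult_monom)
qed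

lemma linear_form_power:
  "(cst a * var_x + cst b * var_y) ^ d = form_of_coeffs d (\<lambda>k. a ^ (d - k) * b ^ k)"
proof -
  have cst_mult: "cst x * cst y = cst (x * y)" for x y by (simp add: cst_def)
  have cst_power: "cst x ^ n = cst (x ^ n)" for x n by (simp add: cst_def poly_const_pow)
  have cst_of_nat: "of_nat n = cst (of_nat n)" for n by (simp add: cst_def of_nat_poly)
  have "(cst a * var_x + cst b * var_y) ^ d = (cst b * var_y + cst a * var_x) ^ d"
    by (simp add: add.commute)
  also have "\<dots> = (\<Sum>k\<le>d. of_nat (d choose k) * (cst b * var_y) ^ k * (cst a * var_x) ^ (d - k))"
    by (rule binomial_ring)
  also have "\<dots> = (\<Sum>k\<le>d. cst (of_nat (d choose k) * (a ^ (d - k) * b ^ k)) * var_x ^ (d - k) * var_y ^ k)"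
    unfolding power_mult_distrib cst_power cst_of_nat cst_mult[symmetric] by (simp add: mult_ac)
  finally show ?thesis by (simp add: form_of_coeffs_def cst_mult_powers)
qed

lemma cst_mult_form_of_coeffs: "cst c * form_of_coeffs d a = form_of_coeffs d (\<lambda>k. c * a k)"
  by (simp add: form_of_coeffs_def sum_distrib_left cst_def smult_monom mult_ac)

lemma sum_form_of_coeffs:
  "(\<Sum>j\<in>A. form_of_coeffs d (a j)) = form_of_coeffs d (\<lambda>k. \<Sum>j\<in>A. a j k)"
proof -
  have "(\<Sum>j\<in>A. monom (monom (of_nat (d choose k) * a j k) (d - k)) k) =
      monom (monom (of_nat (d choose k) * (\<Sum>j\<in>A. a j k)) (d - k)) k" for k
    by (induction A rule: infinite_finite_induct) (simp_all add: add_monom distrib_left)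
  then show ?thesis
    unfolding form_of_coeffs_def by (subst sum.swap) simp
qed

definition sextic_coeff :: "nat \<Rightarrow> complex" where
  "sextic_coeff k = (if k = 1 then 1 else if k = 3 then -1 else 0)"

lemma sextic_eq: "sextic = form_of_coeffs 6 sextic_coeff"
proof -
  have "of_nat n = cst (of_nat n)" for n by (simp add: cst_def of_nat_poly)
  then have "sextic = monom (monom (of_nat (6 choose 1)) 5) 1 - monom (monom (of_nat (6 choose 3)) 3) 3"
    unfolding sextic_def using cst_mult_powers[of _ 5 1] cst_mult_powers[of _ 3 3] by simp
  also have "\<dots> = form_of_coeffs 6 sextic_coeff"
    by (simp add: form_of_coeffs_def sextic_coeff_def eval_nat_numeral minus_monom)
  finally show ?thesis .
qed

lemma has_representation_sextic_iff:
  "has_representation K 6 sextic r \<longleftrightarrow>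
    (\<exists>c \<alpha> \<beta> :: nat \<Rightarrow> complex. (\<forall>j\<in>{1..r}. c j \<in> K \<and> \<alpha> j \<in> K \<and> \<beta> j \<in> K) \<and>
      (\<forall>k\<le>6. (\<Sum>j=1..r. c j * (\<alpha> j ^ (6 - k) * \<beta> j ^ k)) = sextic_coeff k))"
  unfolding has_representation_def sextic_eq linear_form_power cst_mult_form_of_coeffs
    sum_form_of_coeffs form_of_coeffs_eq_iff by (simp only: eq_commute)

lemma sextic_factorization: "sextic = 2 * var_x ^ 3 * var_y * (3 * var_x ^ 2 - 10 * var_y ^ 2)"
proof -
  have "6 choose 1 = 6" "6 choose 3 = 20" by (simp_all add: eval_nat_numeral)
  then show ?thesis
    unfolding sextic_def by (simp add: algebra_simps power_numeral_reduce)
qed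

lemma sum_1_4: "(\<Sum>j=1..4. f j) = f 1 + f 2 + f 3 + f (4 :: nat)" for f :: "nat \<Rightarrow> complex"
  by (simp add: eval_nat_numeral)

lemma sum_1_5: "(\<Sum>j=1..5. f j) = f 1 + f 2 + f 3 + f 4 + f (5 :: nat)" for f :: "nat \<Rightarrow> complex"
  by (simp add: eval_nat_numeral)

text \<open>Combining e3 and e1 gives (u1 + u2) (u3 u4 - u1 u2) = 0. Either u2 = -u1 and u4 = -u3,
  or the pairs have opposite sums and equal products; in each case e2 becomes minus a sum of two
  squares.\<close>

lemma symmetric_functions_sum_squares:
  fixes u1 u2 u3 u4 :: complex
  assumes e1: "u1 + u2 + u3 + u4 = 0"
    and e2: "u1*u2 + u1*u3 + u1*u4 + u2*u3 + u2*u4 + u3*u4 = 1"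
    and e3: "u1*u2*u3 + u1*u2*u4 + u1*u3*u4 + u2*u3*u4 = 0"
  shows "u1 ^ 2 + u2 ^ 2 = -1 \<or> u1 ^ 2 + u3 ^ 2 = -1"
proof -
  have u4: "u4 = - (u1 + u2) - u3" using e1 by (simp add: algebra_simps eq_neg_iff_add_eq_0)
  have "(u1 + u2) * (u3 * u4 - u1 * u2) =
      (u1*u2*u3 + u1*u2*u4 + u1*u3*u4 + u2*u3*u4) - u1 * u2 * (u1 + u2 + u3 + u4)"
    by (simp add: algebra_simps)
  then have "(u1 + u2) * (u3 * u4 - u1 * u2) = 0" unfolding e1 e3 by simp
  then have "u1 + u2 = 0 \<or> u3 * u4 = u1 * u2" by simp
  then consider "u2 = - u1" | "u3 * u4 = u1 * u2" by (auto simp: add_eq_0_iff)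
  then show ?thesis
  proof cases
    case 1
    then have "u4 = - u3" using u4 by simp
    with 1 have "u1 ^ 2 + u3 ^ 2 = - (u1*u2 + u1*u3 + u1*u4 + u2*u3 + u2*u4 + u3*u4)"
      by (simp add: power2_eq_square algebra_simps)
    then have "u1 ^ 2 + u3 ^ 2 = -1" unfolding e2 .
    then show ?thesis ..
  next
    case 2
    have s: "u3 + u4 = - (u1 + u2)" using u4 by simp
    have "u1*u2 + u1*u3 + u1*u4 + u2*u3 + u2*u4 + u3*u4 = u1 * u2 + u3 * u4 + (u1 + u2) * (u3 + u4)"
      by (simp add: algebra_simps)
    also have "\<dots> = - (u1 ^ 2 + u2 ^ 2)"
      unfolding 2 s by (simp add: power2_eq_square algebra_simps)
    finally have "- (u1 ^ 2 + u2 ^ 2) = 1" unfolding e2 by simp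
    then have "u1 ^ 2 + u2 ^ 2 = -1" by (metis minus_minus)
    then show ?thesis ..
  qed
qed

text \<open>The h's are the coefficients of the quartic vanishing at all (a j, b j). Multiplying it
  by the monomials of degree 2 and summing with weights c j yields three linear relations with the
  coefficients of the sextic, namely h1 = h3, h2 = h0 and h1 = 0.\<close>

lemma four_term_representation:
  fixes c a b :: "nat \<Rightarrow> complex"
  assumes nonzero: "\<And>j. j \<in> {1..4} \<Longrightarrow> a j \<noteq> 0 \<or> b j \<noteq> 0"
    and sums: "\<And>k. k \<le> 6 \<Longrightarrow> (\<Sum>j=1..4. c j * (a j ^ (6 - k) * b j ^ k)) = sextic_coeff k"
  shows "\<forall>j\<in>{1..4}. b j \<noteq> 0"
    and "(a 1 / b 1) ^ 2 + (a 2 / b 2) ^ 2 = -1 \<or> (a 1 / b 1) ^ 2 + (a 3 / b 3) ^ 2 = -1"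
proof -
  define h0 where "h0 = b 1 * b 2 * b 3 * b 4"
  define h1 where "h1 = - (a 1 * b 2 * b 3 * b 4 + b 1 * a 2 * b 3 * b 4 + b 1 * b 2 * a 3 * b 4 + b 1 * b 2 * b 3 * a 4)"
  define h2 where "h2 = a 1 * a 2 * b 3 * b 4 + a 1 * b 2 * a 3 * b 4 + a 1 * b 2 * b 3 * a 4
    + b 1 * a 2 * a 3 * b 4 + b 1 * a 2 * b 3 * a 4 + b 1 * b 2 * a 3 * a 4"
  define h3 where "h3 = - (a 1 * a 2 * a 3 * b 4 + a 1 * a 2 * b 3 * a 4 + a 1 * b 2 * a 3 * a 4 + b 1 * a 2 * a 3 * a 4)"
  define h4 where "h4 = a 1 * a 2 * a 3 * a 4"
  have factor: "h0 * x ^ 4 + h1 * x ^ 3 * y + h2 * x ^ 2 * y ^ 2 + h3 * x * y ^ 3 + h4 * y ^ 4 =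
      (b 1 * x - a 1 * y) * (b 2 * x - a 2 * y) * (b 3 * x - a 3 * y) * (b 4 * x - a 4 * y)" for x y
    unfolding h0_def h1_def h2_def h3_def h4_def
    by (simp add: power4_eq_xxxx power3_eq_cube power2_eq_square algebra_simps)
  have root: "h0 * a j ^ 4 + h1 * a j ^ 3 * b j + h2 * a j ^ 2 * b j ^ 2 + h3 * a j * b j ^ 3 + h4 * b j ^ 4 = 0"
    if "j \<in> {1..4}" for j
  proof -
    have "j = 1 \<or> j = 2 \<or> j = 3 \<or> j = 4" using that by auto
    then show ?thesis unfolding factor by (auto simp: mult.commute)
  qed
  have S: "h0 * sextic_coeff l + h1 * sextic_coeff (l + 1) + h2 * sextic_coeff (l + 2)
      + h3 * sextic_coeff (l + 3) + h4 * sextic_coeff (l + 4) = 0" if "l \<le> 2" for l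
  proof -
    have "(\<Sum>j=1..4. c j * (a j ^ (2 - l) * b j ^ l) *
        (h0 * a j ^ 4 + h1 * a j ^ 3 * b j + h2 * a j ^ 2 * b j ^ 2 + h3 * a j * b j ^ 3 + h4 * b j ^ 4)) = 0"
      using root by (intro sum.neutral) simp
    moreover have "c j * (a j ^ (2 - l) * b j ^ l) *
        (h0 * a j ^ 4 + h1 * a j ^ 3 * b j + h2 * a j ^ 2 * b j ^ 2 + h3 * a j * b j ^ 3 + h4 * b j ^ 4) =
        h0 * (c j * (a j ^ (6 - l) * b j ^ l)) + h1 * (c j * (a j ^ (6 - (l + 1)) * b j ^ (l + 1)))
        + h2 * (c j * (a j ^ (6 - (l + 2)) * b j ^ (l + 2))) + h3 * (c j * (a j ^ (6 - (l + 3)) * b j ^ (l + 3)))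
        + h4 * (c j * (a j ^ (6 - (l + 4)) * b j ^ (l + 4)))" for j
    proof -
      have "l = 0 \<or> l = 1 \<or> l = 2" using that by auto
      then show ?thesis by (auto simp: algebra_simps power_numeral_reduce power2_eq_square)
    qed
    ultimately have "h0 * (\<Sum>j=1..4. c j * (a j ^ (6 - l) * b j ^ l))
        + h1 * (\<Sum>j=1..4. c j * (a j ^ (6 - (l + 1)) * b j ^ (l + 1)))
        + h2 * (\<Sum>j=1..4. c j * (a j ^ (6 - (l + 2)) * b j ^ (l + 2)))
        + h3 * (\<Sum>j=1..4. c j * (a j ^ (6 - (l + 3)) * b j ^ (l + 3)))
        + h4 * (\<Sum>j=1..4. c j * (a j ^ (6 - (l + 4)) * b j ^ (l + 4))) = 0"
      by (simp only: sum.distrib sum_distrib_left[symmetric])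
    then show ?thesis using that by (simp only: sums)
  qed
  have h: "h1 = 0" "h3 = 0" "h2 = h0"
    using S[of 0] S[of 1] S[of 2] by (simp_all add: sextic_coeff_def)
  have nz: "a 1 \<noteq> 0 \<or> b 1 \<noteq> 0" "a 2 \<noteq> 0 \<or> b 2 \<noteq> 0" "a 3 \<noteq> 0 \<or> b 3 \<noteq> 0" "a 4 \<noteq> 0 \<or> b 4 \<noteq> 0"
    using nonzero[of 1] nonzero[of 2] nonzero[of 3] nonzero[of 4] by auto
  \<comment> \<open>If h0 = 0, the quartic is h4 y^4, so each of its nonzero linear factors is a
    multiple of y and all b j vanish; then x^5 y could not occur in the sextic.\<close>
  have "h0 \<noteq> 0"
  proof
    assume "h0 = 0"
    then have "b 1 = 0 \<and> b 2 = 0 \<and> b 3 = 0 \<and> b 4 = 0"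
      using h nz unfolding h0_def h1_def h2_def h3_def
      by (cases "b 1 = 0"; cases "b 2 = 0"; cases "b 3 = 0"; cases "b 4 = 0") simp_all
    then have "(\<Sum>j=1..4. c j * (a j ^ (6 - 1) * b j ^ 1)) = 0"
      unfolding sum_1_4 by simp
    then have "sextic_coeff 1 = 0" using sums[of 1] by simp
    then show False by (simp add: sextic_coeff_def)
  qed
  then have b: "b 1 \<noteq> 0" "b 2 \<noteq> 0" "b 3 \<noteq> 0" "b 4 \<noteq> 0" by (auto simp: h0_def)
  show "\<forall>j\<in>{1..4}. b j \<noteq> 0"
  proof
    fix j :: nat assume "j \<in> {1..4}"
    then have "j = 1 \<or> j = 2 \<or> j = 3 \<or> j = 4" by auto
    with b show "b j \<noteq> 0" by blast
  qed
  show "(a 1 / b 1) ^ 2 + (a 2 / b 2) ^ 2 = -1 \<or> (a 1 / b 1) ^ 2 + (a 3 / b 3) ^ 2 = -1"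
  proof (rule symmetric_functions_sum_squares)
    define u where "u = (\<lambda>j. a j / b j)"
    have u: "a j / b j = u j" for j by (simp add: u_def)
    have a: "a 1 = u 1 * b 1" "a 2 = u 2 * b 2" "a 3 = u 3 * b 3" "a 4 = u 4 * b 4"
      using b by (simp_all add: u_def)
    have "h1 = - (h0 * (u 1 + u 2 + u 3 + u 4))"
      unfolding h1_def h0_def a by (simp add: algebra_simps)
    then show "a 1 / b 1 + a 2 / b 2 + a 3 / b 3 + a 4 / b 4 = 0"
      unfolding u using h(1) \<open>h0 \<noteq> 0\<close> by simp
    have "h2 = h0 * (u 1 * u 2 + u 1 * u 3 + u 1 * u 4 + u 2 * u 3 + u 2 * u 4 + u 3 * u 4)"
      unfolding h2_def h0_def a by (simp add: algebra_simps)
    then show "a 1 / b 1 * (a 2 / b 2) + a 1 / b 1 * (a 3 / b 3) + a 1 / b 1 * (a 4 / b 4) +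
        a 2 / b 2 * (a 3 / b 3) + a 2 / b 2 * (a 4 / b 4) + a 3 / b 3 * (a 4 / b 4) = 1"
      unfolding u using h(3) \<open>h0 \<noteq> 0\<close> by simp
    have "h3 = - (h0 * (u 1 * u 2 * u 3 + u 1 * u 2 * u 4 + u 1 * u 3 * u 4 + u 2 * u 3 * u 4))"
      unfolding h3_def h0_def a by (simp add: algebra_simps)
    then show "a 1 / b 1 * (a 2 / b 2) * (a 3 / b 3) + a 1 / b 1 * (a 2 / b 2) * (a 4 / b 4) +
        a 1 / b 1 * (a 3 / b 3) * (a 4 / b 4) + a 2 / b 2 * (a 3 / b 3) * (a 4 / b 4) = 0"
      unfolding u using h(2) \<open>h0 \<noteq> 0\<close> by simp
  qed
qed

section \<open>Representations of length four\<close>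

theorem representation_le_4_imp:
  assumes K: "subfield K complex_field" and rep: "has_representation K 6 sextic r" and "r \<le> 4"
  shows "r = 4" and "\<exists>u\<in>K. \<exists>v\<in>K. u ^ 2 + v ^ 2 = -1"
proof -
  interpret complex_subfield K by (rule complex_subfield.intro[OF K])
  obtain c \<alpha> \<beta> :: "nat \<Rightarrow> complex" where
    in_K: "\<And>j. j \<in> {1..r} \<Longrightarrow> c j \<in> K \<and> \<alpha> j \<in> K \<and> \<beta> j \<in> K" and
    sums: "\<And>k. k \<le> 6 \<Longrightarrow> (\<Sum>j=1..r. c j * (\<alpha> j ^ (6 - k) * \<beta> j ^ k)) = sextic_coeff k"
    using rep unfolding has_representation_sextic_iff by blast
  \<comment> \<open>Missing or zero forms are replaced by \<open>x\<close> with coefficient 0, whose \<open>\<beta>\<close> vanishes.\<close>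
  define good where "good = (\<lambda>j. j \<le> r \<and> (\<alpha> j \<noteq> 0 \<or> \<beta> j \<noteq> 0))"
  define c' where "c' = (\<lambda>j. if good j then c j else 0)"
  define a where "a = (\<lambda>j. if good j then \<alpha> j else 1)"
  define b where "b = (\<lambda>j. if good j then \<beta> j else 0)"
  have nonzero: "a j \<noteq> 0 \<or> b j \<noteq> 0" for j by (auto simp: a_def b_def good_def)
  have sums': "(\<Sum>j=1..4. c' j * (a j ^ (6 - k) * b j ^ k)) = sextic_coeff k" if "k \<le> 6" for k
  proof -
    have "(\<Sum>j=1..4. c' j * (a j ^ (6 - k) * b j ^ k)) = (\<Sum>j=1..r. c' j * (a j ^ (6 - k) * b j ^ k))"
      using \<open>r \<le> 4\<close> by (intro sum.mono_neutral_right) (auto simp: c'_def good_def)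
    also have "\<dots> = (\<Sum>j=1..r. c j * (\<alpha> j ^ (6 - k) * \<beta> j ^ k))"
    proof (intro sum.cong refl)
      fix j assume j: "j \<in> {1..r}"
      show "c' j * (a j ^ (6 - k) * b j ^ k) = c j * (\<alpha> j ^ (6 - k) * \<beta> j ^ k)"
      proof (cases "good j")
        case False
        then have "\<alpha> j = 0" "\<beta> j = 0" using j by (auto simp: good_def)
        then show ?thesis using False that by (cases "k = 0") (simp_all add: c'_def)
      qed (simp add: c'_def a_def b_def)
    qed
    finally show ?thesis using sums[OF that] by simp
  qed
  note four = four_term_representation[OF nonzero sums']
  \<comment> \<open>A padded or zero form has b j = 0, which the nonvanishing of all four b j
    excludes; so no form was padded and r = 4.\<close>
  have good: "good j" if "j \<in> {1..4}" for j using four(1) that by (auto simp: b_def split: if_splits)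
  show "r = 4" using good[of 4] \<open>r \<le> 4\<close> by (simp add: good_def)
  have quot: "a j / b j \<in> K" if "j \<in> {1..4}" for j
    using good[OF that] in_K[of j] that by (auto simp: a_def b_def good_def intro!: mem)
  show "\<exists>u\<in>K. \<exists>v\<in>K. u ^ 2 + v ^ 2 = -1"
    using four(2) quot[of 1] quot[of 2] quot[of 3] by force
qed

lemma le_6_cases: "k \<le> 6 \<Longrightarrow> k \<in> {0, 1, 2, 3, 4, 5, 6 :: nat}"
  by auto

text \<open>Opposite weights at u and -u, and at v and -v, cancel the even moments. The odd moments
  are 2 w (u^(2n) - v^(2n)) for n = 0, 1, 2; w normalizes the second to -1, and u^2 + v^2 = -1 then
  makes the third equal to 1.\<close>

lemma four_term_construction:
  assumes K: "subfield K complex_field" and uv: "u \<in> K" "v \<in> K"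
    and eq: "u ^ 2 + v ^ 2 = -1" and nz: "u \<noteq> 0" "v \<noteq> 0" "u ^ 2 \<noteq> v ^ 2"
  shows "has_representation K 6 sextic 4"
  unfolding has_representation_sextic_iff
proof (intro exI conjI ballI allI impI)
  interpret complex_subfield K by (rule complex_subfield.intro[OF K])
  define w where "w = - 1 / (2 * (u ^ 2 - v ^ 2))"
  define c where "c = (\<lambda>j :: nat. if j = 1 then w / u else if j = 2 then - (w / u)
    else if j = 3 then - (w / v) else w / v)"
  define \<alpha> where "\<alpha> = (\<lambda>j :: nat. if j = 1 then u else if j = 2 then - u
    else if j = 3 then v else - v)"
  have w: "w * (u ^ 2 - v ^ 2) = - 1 / 2" using nz by (simp add: w_def)
  have "w \<in> K" unfolding w_def using uv by (intro mem)
  then show "c j \<in> K" for j using uv by (auto simp: c_def intro!: mem)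
  show "\<alpha> j \<in> K" for j using uv by (auto simp: \<alpha>_def intro!: mem)
  show "(1 :: complex) \<in> K" by (rule mem)
  fix k :: nat assume "k \<le> 6"
  have odd: "(\<Sum>j=1..4. c j * \<alpha> j ^ (2 * n + 1)) = 2 * w * ((u ^ 2) ^ n - (v ^ 2) ^ n)" for n
    unfolding sum_1_4 using nz by (simp add: c_def \<alpha>_def power_add power_mult right_diff_distrib)
  have even: "(\<Sum>j=1..4. c j * \<alpha> j ^ (2 * n)) = 0" for n
    unfolding sum_1_4 by (simp add: c_def \<alpha>_def)
  have "2 * w * ((u ^ 2) ^ 2 - (v ^ 2) ^ 2) = 2 * (w * (u ^ 2 - v ^ 2)) * (u ^ 2 + v ^ 2)"
    by (simp add: power2_eq_square algebra_simps)
  then have "2 * w * ((u ^ 2) ^ 2 - (v ^ 2) ^ 2) = 1" using w unfolding eq by simp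
  moreover have "2 * w * ((u ^ 2) ^ 1 - (v ^ 2) ^ 1) = - 1" using w by (simp add: mult.assoc)
  ultimately show "(\<Sum>j=1..4. c j * (\<alpha> j ^ (6 - k) * 1 ^ k)) = sextic_coeff k"
    using le_6_cases[OF \<open>k \<le> 6\<close>] odd[of 0] odd[of 1] odd[of 2] even[of 0] even[of 1] even[of 2] even[of 3]
    by (auto simp: sextic_coeff_def)
qed

theorem representation_4_if:
  assumes K: "subfield K complex_field" and rs: "r \<in> K" "s \<in> K" and eq: "r ^ 2 + s ^ 2 = -1"
  shows "has_representation K 6 sextic 4"
proof (cases "r \<noteq> 0 \<and> s \<noteq> 0 \<and> r ^ 2 \<noteq> s ^ 2")
  case True
  then show ?thesis using four_term_construction[OF K rs eq] by blast
next
  case False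
  interpret complex_subfield K by (rule complex_subfield.intro[OF K])
  \<comment> \<open>An orthogonal map with entries from the triple 3, 4, 5 preserves the sum of
    squares and takes each degenerate pair, on an axis or a diagonal, into general position.\<close>
  define u where "u = (3 * r + 4 * s) / 5"
  define v where "v = (4 * r - 3 * s) / 5"
  have "u \<in> K" "v \<in> K" unfolding u_def v_def using rs by (auto intro!: mem)
  moreover have "u ^ 2 + v ^ 2 = r ^ 2 + s ^ 2"
    unfolding u_def v_def by (simp add: power2_eq_square field_simps)
  then have "u ^ 2 + v ^ 2 = -1" using eq by simp
  moreover have "u \<noteq> 0 \<and> v \<noteq> 0 \<and> u ^ 2 \<noteq> v ^ 2"
  proof -
    consider "r = 0" | "s = 0" | "r = s" | "r = - s"
      using False by (auto simp: power2_eq_iff)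
    moreover have "r \<noteq> 0 \<or> s \<noteq> 0" using eq by auto
    ultimately show ?thesis
      by cases (auto simp: u_def v_def power_divide power_mult_distrib)
  qed
  ultimately show ?thesis using four_term_construction[OF K] by blast
qed

section \<open>Length and Stufe as least elements\<close>

text \<open>The empty set has infimum \<infinity>, so a finite bound forces the set to be nonempty
  and its infimum to be attained.\<close>

lemma Inf_enat_image_le_iff: "Inf (enat ` {n. P n}) \<le> enat m \<longleftrightarrow> (\<exists>n\<le>m. P n)"
proof
  let ?S = "enat ` {n. P n}"
  assume le: "Inf ?S \<le> enat m"
  have "?S \<noteq> {}"
  proof
    assume "?S = {}"
    show False using le unfolding \<open>?S = {}\<close> by (simp add: Inf_enat_def)
  qed
  then have "Inf ?S = (LEAST x. x \<in> ?S)" by (simp only: Inf_enat_def if_False)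
  moreover have "(LEAST x. x \<in> ?S) \<in> ?S"
    using \<open>?S \<noteq> {}\<close> by (metis (no_types, lifting) LeastI ex_in_conv)
  ultimately obtain n where "Inf ?S = enat n" "P n" by auto
  then show "\<exists>n\<le>m. P n" using le by auto
next
  assume "\<exists>n\<le>m. P n"
  then obtain n where "n \<le> m" "P n" by blast
  then have "Inf (enat ` {n. P n}) \<le> enat n" by (intro Inf_lower) auto
  also have "enat n \<le> enat m" using \<open>n \<le> m\<close> by simp
  finally show "Inf (enat ` {n. P n}) \<le> enat m" .
qed

lemma Inf_enat_image_eq_iff: "Inf (enat ` {n. P n}) = enat m \<longleftrightarrow> P m \<and> (\<forall>n<m. \<not> P n)"
proof -
  have "x = enat m \<longleftrightarrow> x \<le> enat m \<and> (\<forall>l<m. \<not> x \<le> enat l)" for x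
  proof (cases x)
    case (enat k)
    have "k = m" if "k \<le> m" "\<forall>l<m. \<not> k \<le> l"
      using that by (metis le_neq_implies_less order_refl)
    then show ?thesis using enat by auto
  qed simp
  then have "Inf (enat ` {n. P n}) = enat m \<longleftrightarrow> (\<exists>n\<le>m. P n) \<and> (\<forall>l<m. \<not> (\<exists>n\<le>l. P n))"
    unfolding Inf_enat_image_le_iff[symmetric] by blast
  also have "\<dots> \<longleftrightarrow> P m \<and> (\<forall>n<m. \<not> P n)"
    by (auto simp: le_less)
  finally show ?thesis .
qed

lemma stufe_le_2_iff:
  assumes K: "subfield K complex_field"
  shows "stufe K \<le> 2 \<longleftrightarrow> (\<exists>u\<in>K. \<exists>v\<in>K. u ^ 2 + v ^ 2 = -1)"
proof -
  interpret complex_subfield K by (rule complex_subfield.intro[OF K])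
  let ?P = "\<lambda>n. \<exists>c :: nat \<Rightarrow> complex. (\<forall>i\<in>{1..n}. c i \<in> K) \<and> - 1 = (\<Sum>i=1..n. c i ^ 2)"
  have "stufe K \<le> 2 \<longleftrightarrow> (\<exists>n\<le>(2 :: nat). ?P n)"
    unfolding stufe_def Inf_enat_image_le_iff[symmetric] numeral_eq_enat ..
  also have "\<dots> \<longleftrightarrow> (\<exists>u\<in>K. \<exists>v\<in>K. u ^ 2 + v ^ 2 = -1)"
  proof
    assume "\<exists>n\<le>2. ?P n"
    then obtain n :: nat and c where n: "n \<le> 2" "\<forall>i\<in>{1..n}. c i \<in> K" "- 1 = (\<Sum>i=1..n. c i ^ 2 :: complex)" by blast
    then consider "n = 0" | "n = 1" | "n = 2" by linarith
    then show "\<exists>u\<in>K. \<exists>v\<in>K. u ^ 2 + v ^ 2 = -1"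
    proof cases
      case 2
      then have "c 1 \<in> K" "c 1 ^ 2 + 0 ^ 2 = -1" using n by auto
      then show ?thesis using mem(1) by blast
    next
      case 3
      then have "c 1 \<in> K" "c 2 \<in> K" "c 1 ^ 2 + c 2 ^ 2 = -1" using n by (auto simp: eval_nat_numeral)
      then show ?thesis by blast
    qed (use n in auto)
  next
    assume "\<exists>u\<in>K. \<exists>v\<in>K. u ^ 2 + v ^ 2 = -1"
    then obtain u v where uv: "u \<in> K" "v \<in> K" "u ^ 2 + v ^ 2 = -1" by blast
    then have "?P 2"
      by (intro exI[of _ "\<lambda>i. if i = 1 then u else v"]) (auto simp: eval_nat_numeral)
    then show "\<exists>n\<le>2. ?P n" by blast
  qed
  finally show ?thesis .
qed

lemma form_length_4_iff:
  assumes K: "subfield K complex_field"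
  shows "form_length K 6 sextic = 4 \<longleftrightarrow> (\<exists>u\<in>K. \<exists>v\<in>K. u ^ 2 + v ^ 2 = -1)"
  unfolding form_length_def numeral_eq_enat Inf_enat_image_eq_iff
proof
  assume "has_representation K 6 sextic 4 \<and> (\<forall>n<4. \<not> has_representation K 6 sextic n)"
  then show "\<exists>u\<in>K. \<exists>v\<in>K. u ^ 2 + v ^ 2 = -1" using representation_le_4_imp(2)[OF K, of 4] by simp
next
  assume "\<exists>u\<in>K. \<exists>v\<in>K. u ^ 2 + v ^ 2 = -1"
  then show "has_representation K 6 sextic 4 \<and> (\<forall>n<4. \<not> has_representation K 6 sextic n)"
    using representation_4_if[OF K] representation_le_4_imp(1)[OF K] by fastforce
qed

section \<open>Sums of two squares in imaginary quadratic fields\<close>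

lemma subfield_quadratic_field: "subfield (quadratic_field n) complex_field"
proof -
  interpret R: field complex_field by (rule field_from_type_algebra)
  show ?thesis unfolding quadratic_field_def
    by (rule R.generate_field_is_subfield) (simp add: ring_of_type_algebra_def)
qed

lemma csqrt_mem_quadratic_field: "csqrt (of_int n) \<in> quadratic_field n"
  unfolding quadratic_field_def by (rule generate_field.incl) simp

text \<open>With \<omega>^2 = -m the relation reads (\<omega> w)^2 + x^2 = -(y^2 + z^2), and a
  quotient of two sums of two squares is again one. If y = z = 0, then -1 is itself a
  square.\<close>

theorem sum_two_squares_quadratic_field:
  fixes m :: nat
  assumes "m > 0" "squarefree m" "m mod 8 \<noteq> 7"
  shows "\<exists>u\<in>quadratic_field (- int m). \<exists>v\<in>quadratic_field (- int m). u ^ 2 + v ^ 2 = -1"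
proof -
  interpret complex_subfield "quadratic_field (- int m)"
    by (rule complex_subfield.intro[OF subfield_quadratic_field])
  define \<omega> where "\<omega> = csqrt (of_int (- int m))"
  have \<omega>: "\<omega> \<in> quadratic_field (- int m)" "\<omega> ^ 2 = - of_nat m"
    using csqrt_mem_quadratic_field[of "- int m"] power2_csqrt[of "of_int (- int m)"]
    unfolding \<omega>_def by (blast, simp only: of_int_minus of_int_of_nat_eq)
  obtain w x y z :: int where eq: "int m * w ^ 2 = x ^ 2 + y ^ 2 + z ^ 2" and w: "w \<noteq> 0"
    using three_rational_squares[OF assms] .
  define w1 x1 y1 z1 where "w1 = (of_int w :: complex)" and "x1 = (of_int x :: complex)"
    and "y1 = (of_int y :: complex)" and "z1 = (of_int z :: complex)"
  have mem': "w1 \<in> quadratic_field (- int m)" "x1 \<in> quadratic_field (- int m)"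
    "y1 \<in> quadratic_field (- int m)" "z1 \<in> quadratic_field (- int m)"
    by (simp_all add: w1_def x1_def y1_def z1_def mem)
  have "of_nat m * w1 ^ 2 = x1 ^ 2 + y1 ^ 2 + z1 ^ 2"
    using arg_cong[OF eq, of "of_int :: int \<Rightarrow> complex"] by (simp add: w1_def x1_def y1_def z1_def)
  then have rel: "(\<omega> * w1) ^ 2 + x1 ^ 2 = - (y1 ^ 2 + z1 ^ 2)"
    by (simp add: power_mult_distrib \<omega>(2))
  show ?thesis
  proof (cases "y = 0 \<and> z = 0")
    case True
    have "x \<noteq> 0" using eq True w assms(1) by auto
    then have "x1 \<noteq> 0" by (simp add: x1_def)
    have "(\<omega> * w1 / x1) ^ 2 + 0 ^ 2 = -1"
      using rel True \<open>x1 \<noteq> 0\<close> by (simp add: power_divide y1_def z1_def field_simps eq_neg_iff_add_eq_0)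
    then show ?thesis using \<omega> mem' by (intro bexI[of _ "\<omega> * w1 / x1"] bexI[of _ 0]) (auto intro!: mem)
  next
    case False
    define d where "d = y1 ^ 2 + z1 ^ 2"
    have "y ^ 2 + z ^ 2 \<noteq> 0" using False by (simp add: sum_power2_eq_zero_iff)
    moreover have "d = of_int (y ^ 2 + z ^ 2)" by (simp add: d_def y1_def z1_def)
    ultimately have "d \<noteq> 0" by (simp only: of_int_eq_0_iff not_False_eq_True)
    define u where "u = (\<omega> * w1 * y1 + x1 * z1) / d"
    define v where "v = (\<omega> * w1 * z1 - x1 * y1) / d"
    have "(\<omega> * w1 * y1 + x1 * z1) ^ 2 + (\<omega> * w1 * z1 - x1 * y1) ^ 2 = ((\<omega> * w1) ^ 2 + x1 ^ 2) * d"
      by (simp add: d_def power2_eq_square algebra_simps)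
    then have "u ^ 2 + v ^ 2 = -1"
      using \<open>d \<noteq> 0\<close> unfolding u_def v_def power_divide add_divide_distrib[symmetric] rel d_def[symmetric]
      by (simp add: power2_eq_square)
    moreover have "u \<in> quadratic_field (- int m)" "v \<in> quadratic_field (- int m)"
      unfolding u_def v_def d_def using \<omega> mem' by (auto intro!: mem)
    ultimately show ?thesis by blast
  qed
qed

text \<open>Infinite descent: squares are 0, 1 or 4 modulo 8, which forces all four numbers to be
  even, and halving them gives a smaller solution.\<close>

lemma seven_not_sum_three_squares:
  fixes w x y z :: int
  assumes "7 * w ^ 2 = x ^ 2 + y ^ 2 + z ^ 2"
  shows "w = 0"
  using assms
proof (induction "nat \<bar>w\<bar>" arbitrary: w x y z rule: less_induct)
  case less
  have odd_sq: "n ^ 2 mod 8 = 1" if "odd n" for n :: int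
  proof -
    from that obtain k where "n = 2 * k + 1" by (elim oddE)
    then have "n ^ 2 = 4 * (k * (k + 1)) + 1" by (simp add: power2_eq_square algebra_simps)
    moreover have "even (k * (k + 1))" by simp
    then obtain j where "k * (k + 1) = 2 * j" by (elim evenE)
    ultimately have "n ^ 2 = 1 + 8 * j" by simp
    then show ?thesis by (simp only: mod_mult_self2) simp
  qed
  have even_sq: "n ^ 2 mod 8 = 0 \<or> n ^ 2 mod 8 = 4" if "even n" for n :: int
  proof -
    from that obtain k where "n = 2 * k" by (elim evenE)
    then have sq: "n ^ 2 = 4 * k ^ 2" by (simp add: power_mult_distrib)
    have "4 * a mod 8 = 0 \<or> 4 * a mod 8 = 4" for a :: int by presburger
    from this[of "k ^ 2"] show ?thesis unfolding sq .
  qed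
  have "(7 * (w ^ 2 mod 8)) mod 8 = (x ^ 2 mod 8 + y ^ 2 mod 8 + z ^ 2 mod 8) mod 8"
  proof -
    have "(x ^ 2 mod 8 + y ^ 2 mod 8 + z ^ 2 mod 8) mod 8 = (x ^ 2 + y ^ 2 + z ^ 2) mod 8"
      by (intro mod_add_cong) simp_all
    then show ?thesis unfolding mod_mult_right_eq less.prems by simp
  qed
  moreover have "p \<and> q \<and> r \<and> s"
    if "7 * A mod 8 = (B + C + D) mod 8" "if p then A = 0 \<or> A = 4 else A = 1"
      "if q then B = 0 \<or> B = 4 else B = 1" "if r then C = 0 \<or> C = 4 else C = 1"
      "if s then D = 0 \<or> D = 4 else D = 1" for A B C D :: int and p q r s
    using that by (cases p; cases q; cases r; cases s) auto
  moreover have "if even n then n ^ 2 mod 8 = 0 \<or> n ^ 2 mod 8 = 4 else n ^ 2 mod 8 = 1" for n :: int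
    using odd_sq even_sq by simp
  ultimately have "even w \<and> even x \<and> even y \<and> even z" by blast
  then obtain w' x' y' z' where half: "w = 2 * w'" "x = 2 * x'" "y = 2 * y'" "z = 2 * z'"
    by (auto elim!: evenE)
  have "7 * w' ^ 2 = x' ^ 2 + y' ^ 2 + z' ^ 2"
    using less.prems unfolding half by (simp add: power_mult_distrib)
  then have "w' = 0" if "w \<noteq> 0"
    using less.hyps[of w' x' y' z'] that half by (simp add: abs_mult)
  then show ?case using half by auto
qed

section \<open>The quadratic field of discriminant -7\<close>

lemma seven_not_sum_three_rational_squares:
  fixes w x y z :: real
  assumes "w \<in> \<rat>" "x \<in> \<rat>" "y \<in> \<rat>" "z \<in> \<rat>" and eq: "7 * w ^ 2 = x ^ 2 + y ^ 2 + z ^ 2"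
  shows "w = 0"
proof -
  obtain pw qw where w: "w = of_int pw / of_int qw" "qw > 0" using assms(1) by (rule Rats_cases')
  obtain px qx where x: "x = of_int px / of_int qx" "qx > 0" using assms(2) by (rule Rats_cases')
  obtain py qy where y: "y = of_int py / of_int qy" "qy > 0" using assms(3) by (rule Rats_cases')
  obtain pz qz where z: "z = of_int pz / of_int qz" "qz > 0" using assms(4) by (rule Rats_cases')
  define q :: real where "q = of_int (qw * qx * qy * qz)"
  have "q \<noteq> 0" using w x y z by (simp add: q_def)
  have "7 * (w * q) ^ 2 = (x * q) ^ 2 + (y * q) ^ 2 + (z * q) ^ 2"
    using arg_cong[OF eq, of "\<lambda>t. t * q ^ 2"] by (simp add: power_mult_distrib algebra_simps)
  moreover have "w * q = of_int (pw * qx * qy * qz)" "x * q = of_int (px * qw * qy * qz)"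
    "y * q = of_int (py * qw * qx * qz)" "z * q = of_int (pz * qw * qx * qy)"
    using w x y z by (simp_all add: q_def)
  ultimately have "7 * (pw * qx * qy * qz) ^ 2 =
      (px * qw * qy * qz) ^ 2 + (py * qw * qx * qz) ^ 2 + (pz * qw * qx * qy) ^ 2"
    by (simp only: of_int_eq_iff[symmetric, where ?'a = real] of_int_add of_int_mult of_int_power of_int_numeral)
  then have "pw * qx * qy * qz = 0" by (rule seven_not_sum_three_squares)
  then show ?thesis using w x y z by simp
qed

lemma csqrt_minus_7: "Re (csqrt (-7)) = 0" "Im (csqrt (-7)) = sqrt 7" "csqrt (-7) ^ 2 = -7"
  by (simp, simp, rule power2_csqrt)

lemma quadratic_field_minus_7_elements:
  assumes "x \<in> quadratic_field (- 7)"
  shows "\<exists>a\<in>\<rat>. \<exists>b\<in>\<rat>. x = of_real a + of_real b * csqrt (-7)"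
  using assms unfolding quadratic_field_def
proof (induction rule: generate_field.induct)
  case one
  show ?case by (intro bexI[of _ 1] bexI[of _ 0]) (simp_all add: ring_of_type_algebra_def)
next
  case (incl h)
  then show ?case by (intro bexI[of _ 0] bexI[of _ 1]) simp_all
next
  case (a_inv h)
  interpret R: field complex_field by (rule field_from_type_algebra)
  have "\<ominus>\<^bsub>complex_field\<^esub> h + h = 0"
    using R.l_neg[of h] by (simp add: ring_of_type_algebra_def)
  then have neg: "\<ominus>\<^bsub>complex_field\<^esub> h = - h" by (simp add: eq_neg_iff_add_eq_0)
  obtain a b where "a \<in> \<rat>" "b \<in> \<rat>" "h = of_real a + of_real b * csqrt (-7)" using a_inv by blast
  then show ?case unfolding neg by (intro bexI[of _ "- a"] bexI[of _ "- b"]) simp_all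
next
  case (m_inv h)
  interpret R: field complex_field by (rule field_from_type_algebra)
  have "h \<noteq> 0" using m_inv by (simp add: ring_of_type_algebra_def)
  then have "h * (inv\<^bsub>complex_field\<^esub> h) = 1"
    using R.field_Units R.Units_r_inv[of h] by (simp add: ring_of_type_algebra_def)
  then have inv: "inv\<^bsub>complex_field\<^esub> h = inverse h" by (metis inverse_unique)
  obtain a b where ab: "a \<in> \<rat>" "b \<in> \<rat>" "h = of_real a + of_real b * csqrt (-7)" using m_inv by blast
  \<comment> \<open>The norm of h, through which the inverse is written in the same shape; it is
    positive for nonzero h.\<close>
  define N where "N = a ^ 2 + 7 * b ^ 2"
  have "a \<noteq> 0 \<or> b \<noteq> 0" using ab \<open>h \<noteq> 0\<close> by auto
  then have "N \<noteq> 0" unfolding N_def by (auto simp: add_nonneg_eq_0_iff)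
  have "h * (of_real a - of_real b * csqrt (-7)) = of_real a ^ 2 - of_real b ^ 2 * csqrt (-7) ^ 2"
    unfolding ab by (simp add: power2_eq_square algebra_simps)
  also have "\<dots> = of_real N" unfolding csqrt_minus_7 N_def by simp
  finally have "h * ((of_real a - of_real b * csqrt (-7)) / of_real N) = 1"
    using \<open>N \<noteq> 0\<close> by simp
  then have "inverse h = (of_real a - of_real b * csqrt (-7)) / of_real N" by (rule inverse_unique)
  also have "\<dots> = of_real (a / N) + of_real (- b / N) * csqrt (-7)" by (simp add: diff_divide_distrib)
  finally show ?case unfolding inv using ab
    by (intro bexI[of _ "a / N"] bexI[of _ "- b / N"]) (auto simp: N_def)
next
  case (eng_add h1 h2)
  then obtain a b a' b' where "a \<in> \<rat>" "b \<in> \<rat>" "h1 = of_real a + of_real b * csqrt (-7)"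
    "a' \<in> \<rat>" "b' \<in> \<rat>" "h2 = of_real a' + of_real b' * csqrt (-7)" by blast
  then show ?case
    by (intro bexI[of _ "a + a'"] bexI[of _ "b + b'"])
      (simp_all add: ring_of_type_algebra_def algebra_simps)
next
  case (eng_mult h1 h2)
  then obtain a b a' b' where ab: "a \<in> \<rat>" "b \<in> \<rat>" "h1 = of_real a + of_real b * csqrt (-7)"
    "a' \<in> \<rat>" "b' \<in> \<rat>" "h2 = of_real a' + of_real b' * csqrt (-7)" by blast
  have "h1 * h2 = of_real a * of_real a' + (of_real a * of_real b' + of_real b * of_real a') * csqrt (-7)
      + of_real b * of_real b' * csqrt (-7) ^ 2"
    unfolding ab by (simp add: power2_eq_square algebra_simps)
  also have "\<dots> = of_real (a * a' - 7 * b * b') + of_real (a * b' + b * a') * csqrt (-7)"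
    unfolding csqrt_minus_7 by simp
  finally show ?case using ab
    by (intro bexI[of _ "a * a' - 7 * b * b'"] bexI[of _ "a * b' + b * a'"])
      (simp_all add: ring_of_type_algebra_def)
qed

text \<open>With N = b^2 + d^2, real and imaginary parts give a^2 + c^2 = 7 N - 1 and a b + c d = 0.
  The two-square identity for (a^2 + c^2) N then yields 7 N^2 = (a d - b c)^2 + b^2 + d^2 with N >
  0.\<close>

lemma quadratic_field_minus_7_not_sum_two_squares:
  assumes "u \<in> quadratic_field (- 7)" "v \<in> quadratic_field (- 7)"
  shows "u ^ 2 + v ^ 2 \<noteq> -1"
proof
  assume eq: "u ^ 2 + v ^ 2 = -1"
  obtain a b where ab: "a \<in> \<rat>" "b \<in> \<rat>" "u = of_real a + of_real b * csqrt (-7)"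
    using quadratic_field_minus_7_elements[OF assms(1)] by blast
  obtain c d where cd: "c \<in> \<rat>" "d \<in> \<rat>" "v = of_real c + of_real d * csqrt (-7)"
    using quadratic_field_minus_7_elements[OF assms(2)] by blast
  have u: "Re u = a" "Im u = b * sqrt 7" and v: "Re v = c" "Im v = d * sqrt 7"
    unfolding ab cd by (simp_all add: csqrt_minus_7)
  have re: "a ^ 2 + c ^ 2 + 1 = 7 * (b ^ 2 + d ^ 2)"
    using arg_cong[OF eq, of Re] by (simp add: Re_power2 u v power_mult_distrib)
  have im: "a * b + c * d = 0"
  proof -
    have "2 * sqrt 7 * (a * b + c * d) = Im (u ^ 2 + v ^ 2)"
      by (simp add: Im_power2 u v algebra_simps)
    then show ?thesis unfolding eq by simp
  qed
  define N where "N = b ^ 2 + d ^ 2"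
  have "0 < 7 * N" unfolding N_def re[symmetric] by (intro add_nonneg_pos add_nonneg_nonneg) simp_all
  then have "N > 0" by simp
  have "(a ^ 2 + c ^ 2) * N = (a * b + c * d) ^ 2 + (a * d - b * c) ^ 2"
    unfolding N_def by (simp add: power2_eq_square algebra_simps)
  moreover have "a ^ 2 + c ^ 2 = 7 * N - 1" using re by (simp add: N_def)
  ultimately have "(7 * N - 1) * N = (a * d - b * c) ^ 2" using im by simp
  moreover have "(7 * N - 1) * N = 7 * N ^ 2 - N"
    by (simp add: power2_eq_square left_diff_distrib)
  ultimately have "7 * N ^ 2 = (a * d - b * c) ^ 2 + b ^ 2 + d ^ 2"
    using N_def by linarith
  then have "N = 0" using ab cd
    by (intro seven_not_sum_three_rational_squares[of N "a * d - b * c" b d]) (auto simp: N_def)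
  with \<open>N > 0\<close> show False by simp
qed

lemma representation_5_if_sqrt_minus_7:
  assumes K: "subfield K complex_field" and w: "w \<in> K" "w ^ 2 = -7"
  shows "has_representation K 6 sextic 5"
  unfolding has_representation_sextic_iff
proof (intro exI conjI ballI allI impI)
  interpret complex_subfield K by (rule complex_subfield.intro[OF K])
  \<comment> \<open>The forms x and y affect only k = 0 and k = 6. The others have ratios 1/w, 2/w,
    -3/w with e1 = 0 and e2 = -7/w^2 = 1, so their cubic is apolar to the coefficients at k = 1,
    ..., 5, and three weights meet these five conditions. The first two weights then correct k = 0
    and k = 6.\<close>
  define c where "c = (\<lambda>j :: nat. if j = 1 then 6 / 7 / w else if j = 2 then - 49 / 6 / w
    else if j = 3 then - 1 / 28 / w else if j = 4 then 1 / 70 / w else - 1 / 420 / w)"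
  define \<alpha> where "\<alpha> = (\<lambda>j :: nat. if j = 1 then 1 else if j = 2 then 0
    else if j = 3 then 1 else if j = 4 then 2 else (- 3 :: complex))"
  define \<beta> where "\<beta> = (\<lambda>j :: nat. if j = 1 then 0 else if j = 2 then 1 else w)"
  show "c j \<in> K" "\<alpha> j \<in> K" "\<beta> j \<in> K" for j
    using w by (auto simp: c_def \<alpha>_def \<beta>_def intro!: mem)
  fix k :: nat assume "k \<le> 6"
  have "w \<noteq> 0" using w(2) by auto
  have odd_powers: "w ^ 3 = - 7 * w" "w ^ 4 = 49" "w ^ 5 = 49 * w" "w ^ 6 = - 343"
    using w(2) power_add[of w 2 1] power_add[of w 2 2] power_add[of w "2 + 2" 1] power_add[of w "2 + 2" 2]
    by simp_all
  show "(\<Sum>j=1..5. c j * (\<alpha> j ^ (6 - k) * \<beta> j ^ k)) = sextic_coeff k"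
    unfolding sum_1_5 using le_6_cases[OF \<open>k \<le> 6\<close>] \<open>w \<noteq> 0\<close>
    by (elim insertE emptyE)
      (simp_all add: c_def \<alpha>_def \<beta>_def sextic_coeff_def odd_powers w(2) field_simps)
qed

theorem theorem4p2:
  shows "sextic = 2 * var_x ^ 3 * var_y * (3 * var_x ^ 2 - 10 * var_y ^ 2)
    \<and> (\<forall>K. subfield K complex_field \<longrightarrow>
          (form_length K 6 sextic = 4 \<longleftrightarrow> stufe K \<le> 2))
    \<and> (\<forall>m::nat. m > 0 \<and> squarefree m \<and> m mod 8 \<noteq> 7 \<longrightarrow>
          form_length (quadratic_field (- int m)) 6 sextic = 4)
    \<and> form_length (quadratic_field (- 7)) 6 sextic = 5"
proof (intro conjI allI impI)
  show "sextic = 2 * var_x ^ 3 * var_y * (3 * var_x ^ 2 - 10 * var_y ^ 2)"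
    by (rule sextic_factorization)
  show "form_length K 6 sextic = 4 \<longleftrightarrow> stufe K \<le> 2" if "subfield K complex_field" for K
    using form_length_4_iff[OF that] stufe_le_2_iff[OF that] by simp
  show "form_length (quadratic_field (- int m)) 6 sextic = 4"
    if "m > 0 \<and> squarefree m \<and> m mod 8 \<noteq> 7" for m :: nat
    using that sum_two_squares_quadratic_field[of m]
    by (simp add: form_length_4_iff[OF subfield_quadratic_field])
  have "has_representation (quadratic_field (- 7)) 6 sextic 5"
    using representation_5_if_sqrt_minus_7[OF subfield_quadratic_field] csqrt_minus_7(3)
      csqrt_mem_quadratic_field[of "-7"] by simp
  moreover have "\<not> has_representation (quadratic_field (- 7)) 6 sextic r" if "r < 5" for r
    using representation_le_4_imp(2)[OF subfield_quadratic_field, of "-7" r] that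
      quadratic_field_minus_7_not_sum_two_squares by fastforce
  ultimately show "form_length (quadratic_field (- 7)) 6 sextic = 5"
    unfolding form_length_def numeral_eq_enat Inf_enat_image_eq_iff by simp
qed

end
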